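(* Let $\xi'=\sum_{i\ge 0}\sum_{j=1}^{L'_i}\delta_{T'_i+T'_{ij}}$ be a renewal cluster point process with increments $X'_i$, $\mu=\mathbb{E}X'_1$, and $R'_i=\sup_{j\le L'_i}|T'_{ij}|$. Suppose that $L'_0$, $L'_1$, $L'_1X'_1$ and $L'_1R'_1$ all have finite mean. Then for all $x>0$, $$\mathbb{E}\,\xi'(t,t+x]\ \longrightarrow\ \frac1\mu\,\mathbb{E}[L'_1]\,x\qquad\text{as } t\to\infty.$$
   Context: Notation: $\mathbb{R}_+=[0,\infty)$; $M_p(\mathbb{R})$ is the space of point measures on $\mathbb{R}$ finite on all bounded sets. A nonnegative random variable is nonarithmetic if its law is not concentrated on $h\mathbb{Z}$ for any $h>0$. Renewal cluster point process $\xi'$: let $(X'_i)_{i\ge1}$ be nonnegative random variables with a nonarithmetic distribution and finite mean $\mu>0$, and let $\xi'_i$, $i\ge 1$, be point processes on $\mathbb{R}$ such that the pairs $W'_i=(\xi'_i,X'_i)$, $i\ge1$, are i.i.d. ($\xi'_i$ and $X'_i$ may be dependent). Let $W'_0=(\xi'_0,X'_0)$ be a random element of $M_p(\mathbb{R})\times\mathbb{R}_+$ independent of $(W'_i)_{i\ge1}$ (its law may differ from that of $W'_1$). Each $\xi'_i=\sum_{j=1}^{L'_i}\delta_{T'_{ij}}$, where $L'_i$ is an $\mathbb{N}_0$-valued random variable, assumed almost surely finite for every $i\ge0$, and $T'_{i1},T'_{i2},\ldots$ are real random variables; $W'_i$ is identified with $(L'_i,(T'_{ij})_j,X'_i)$,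 a random element of $\mathbb{N}_0\times\mathbb{R}^{\mathbb{N}}\times\mathbb{R}_+$. Put $T'_i=\sum_{j=0}^iX'_j$, $i\ge0$, and $\xi'(B)=\sum_{i\ge0}\xi'_i(B-T'_i)=\sum_{i\ge0}\sum_{j=1}^{L'_i}\delta_{T'_i+T'_{ij}}(B)$ for Borel $B\subseteq\mathbb{R}$; it is assumed throughout that almost surely $\xi'(B)<\infty$ for all bounded Borel $B$. Here $R'_i=\sup_{j\le L'_i}|T'_{ij}|\in[0,\infty)$, $i\ge0$, with $R'_i=0$ if $L'_i=0$. *)

theory Defs
  imports "HOL-Probability.Probability"
begin

text \<open>
  Throughout, \<open>L i\<close> is the number of points of the \<open>i\<close>-th cluster, \<open>T i j\<close> with
  \<open>1 \<le> j \<le> L i\<close> are the positions of these points relative to the renewal time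
  \<open>renewal_time X i\<close> (written \<open>T'\<^sub>i\<close> on paper, with one index), and \<open>X i\<close> are the increments.
  The values \<open>T i 0\<close> are never used.
\<close>

definition nonarithmetic :: "real measure \<Rightarrow> bool" where
  "nonarithmetic N \<longleftrightarrow> \<not> (\<exists>h>0. AE x in N. x \<in> range (\<lambda>k::int. h * of_int k))"

definition renewal_time :: "(nat \<Rightarrow> 'a \<Rightarrow> real) \<Rightarrow> nat \<Rightarrow> 'a \<Rightarrow> real" where
  "renewal_time X i \<omega> = (\<Sum>j=0..i. X j \<omega>)"

definition cluster_process ::
  "(nat \<Rightarrow> 'a \<Rightarrow> nat) \<Rightarrow> (nat \<Rightarrow> nat \<Rightarrow> 'a \<Rightarrow> real) \<Rightarrow> (nat \<Rightarrow> 'a \<Rightarrow> real) \<Rightarrow> 'a \<Rightarrow> real measure" where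
  "cluster_process L T X \<omega> = measure_of UNIV (sets borel)
     (\<lambda>B. \<Sum>i. \<Sum>j=1..L i \<omega>. indicator B (renewal_time X i \<omega> + T i j \<omega>))"

lemma space_cluster_process [simp]: "space (cluster_process L T X \<omega>) = UNIV"
  unfolding cluster_process_def by (rule space_measure_of) simp

lemma sets_cluster_process [simp, measurable_cong]: "sets (cluster_process L T X \<omega>) = sets borel"
  unfolding cluster_process_def
  using sets.sigma_sets_eq[of "borel :: real measure"] by (simp add: sets_measure_of)

text \<open>The set function above is countably additive, so it is the value of the measure.\<close>

lemma emeasure_cluster_process:
  assumes "B \<in> sets borel"
  shows "emeasure (cluster_process L T X \<omega>) B =
    (\<Sum>i. \<Sum>j=1..L i \<omega>. indicator B (renewal_time X i \<omega> + T i j \<omega>))"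
  unfolding cluster_process_def
proof (rule emeasure_measure_of_sigma)
  show "sigma_algebra UNIV (sets (borel :: real measure))"
    using sets.sigma_algebra_axioms[of "borel :: real measure"] by simp
  show "positive (sets borel) (\<lambda>B. \<Sum>i. \<Sum>j=1..L i \<omega>. indicator B (renewal_time X i \<omega> + T i j \<omega>) :: ennreal)"
    by (simp add: positive_def)
  show "countably_additive (sets borel)
      (\<lambda>B. \<Sum>i. \<Sum>j=1..L i \<omega>. indicator B (renewal_time X i \<omega> + T i j \<omega>) :: ennreal)"
  proof (rule countably_additiveI)
    fix A :: "nat \<Rightarrow> real set" assume "disjoint_family A"
    then have *: "(\<Sum>n. indicator (A n) y) = (indicator (\<Union>n. A n) y :: ennreal)" for y
      by (rule suminf_indicator)
    have "(\<Sum>n. \<Sum>i. \<Sum>j=1..L i \<omega>. indicator (A n) (renewal_time X i \<omega> + T i j \<omega>) :: ennreal)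
        = (\<Sum>i. \<Sum>n. \<Sum>j=1..L i \<omega>. indicator (A n) (renewal_time X i \<omega> + T i j \<omega>))"
      by (subst (1) nn_integral_count_space_nat[symmetric], subst nn_integral_suminf)
        (simp_all add: nn_integral_count_space_nat)
    also have "\<dots> = (\<Sum>i. \<Sum>j=1..L i \<omega>. \<Sum>n. indicator (A n) (renewal_time X i \<omega> + T i j \<omega>))"
      by (intro suminf_cong suminf_sum summableI)
    finally show "(\<Sum>n. \<Sum>i. \<Sum>j=1..L i \<omega>. indicator (A n) (renewal_time X i \<omega> + T i j \<omega>) :: ennreal)
        = (\<Sum>i. \<Sum>j=1..L i \<omega>. indicator (\<Union>n. A n) (renewal_time X i \<omega> + T i j \<omega>))"
      by (simp add: *)
  qed
qed (use assms in simp)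

definition cluster_radius ::
  "(nat \<Rightarrow> 'a \<Rightarrow> nat) \<Rightarrow> (nat \<Rightarrow> nat \<Rightarrow> 'a \<Rightarrow> real) \<Rightarrow> nat \<Rightarrow> 'a \<Rightarrow> real" where
  "cluster_radius L T i \<omega> = (if L i \<omega> = 0 then 0 else SUP j\<in>{1..L i \<omega>}. \<bar>T i j \<omega>\<bar>)"

text \<open>The pair of a cluster and an increment is encoded by count, positions and increment.\<close>

type_synonym cluster = "nat \<times> (nat \<Rightarrow> real) \<times> real"

definition cluster_space :: "cluster measure" where
  "cluster_space = count_space UNIV \<Otimes>\<^sub>M (\<Pi>\<^sub>M j\<in>{1..}. borel) \<Otimes>\<^sub>M borel"

definition cluster_pair ::
  "(nat \<Rightarrow> 'a \<Rightarrow> nat) \<Rightarrow> (nat \<Rightarrow> nat \<Rightarrow> 'a \<Rightarrow> real) \<Rightarrow> (nat \<Rightarrow> 'a \<Rightarrow> real) \<Rightarrow> nat \<Rightarrow> 'a \<Rightarrow> cluster" where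
  "cluster_pair L T X i \<omega> = (L i \<omega>, (\<lambda>j\<in>{1..}. T i j \<omega>), X i \<omega>)"

text \<open>
  \<open>indep_initial\<close> says that the initial pair is independent of the whole sequence of later pairs;
  it uses \<open>indep_set\<close> because \<open>indep_var\<close> needs both variables to have the same value type.
\<close>

locale renewal_cluster_process = prob_space M for M :: "'a measure" +
  fixes L :: "nat \<Rightarrow> 'a \<Rightarrow> nat"
    and T :: "nat \<Rightarrow> nat \<Rightarrow> 'a \<Rightarrow> real"
    and X :: "nat \<Rightarrow> 'a \<Rightarrow> real"
  assumes random_pair: "\<And>i. random_variable cluster_space (cluster_pair L T X i)"
    and X_nonneg: "\<And>i \<omega>. \<omega> \<in> space M \<Longrightarrow> 0 \<le> X i \<omega>"
    and indep_pairs: "indep_vars (\<lambda>_. cluster_space) (cluster_pair L T X) {1..}"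
    and ident_pairs: "\<And>i. 1 \<le> i \<Longrightarrow>
      distr M cluster_space (cluster_pair L T X i) = distr M cluster_space (cluster_pair L T X 1)"
    and indep_initial: "indep_set
      (sets (vimage_algebra (space M) (cluster_pair L T X 0) cluster_space))
      (sets (vimage_algebra (space M) (\<lambda>\<omega>. \<lambda>i\<in>{1..}. cluster_pair L T X i \<omega>)
        (\<Pi>\<^sub>M i\<in>{1..}. cluster_space)))"
    and nonarithmetic_X: "nonarithmetic (distr M borel (X 1))"
    and integrable_X: "integrable M (X 1)"
    and mean_X_pos: "0 < expectation (X 1)"
    and locally_finite: "AE \<omega> in M. \<forall>B\<in>sets borel. bounded B \<longrightarrow>
      emeasure (cluster_process L T X \<omega>) B < \<infinity>"

end

theory Submission
  imports Defs
begin

text \<open>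
  The proof reduces the mean measure of the cluster process to the renewal measure \<open>U\<close>, the sum of
  the laws of the renewal times \<open>S 0, S 1, \<dots>\<close>. The time \<open>S n\<close> is independent of the next pair, made of
  cluster and increment, so the clusters with positive index have mean measure
  \<open>E (\<Sum>j\<le>L 1. U {t - X 1 - T 1 j <.. t - X 1 - T 1 j + x})\<close> on the window (\<open>intensity_decomposition\<close>).
  By Blackwell's renewal theorem each term tends to \<open>x / \<mu>\<close>. As \<open>U\<close> is bounded on windows of fixed
  length, a multiple of \<open>L 1\<close> dominates the sum and the expectation tends to \<open>E (L 1) * x / \<mu>\<close>. The
  initial cluster has at most \<open>L 0\<close> points, and they are left behind by the window.

  Blackwell's theorem (\<open>blackwell\<close>) is proved here for an arbitrary delay. Let \<open>f\<close> be the convolution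
  of \<open>U\<close> with a trapezoid. It is bounded and uniformly continuous, and \<open>f t - E (f (t - X 1))\<close> tends
  to zero. For a nonarithmetic law this forces \<open>f (t + h) - f t\<close> to vanish at infinity for every
  \<open>h\<close> (\<open>asymptotically_harmonic_increments_vanish\<close>): by a maximum principle this holds for shifts in
  the support of the law, and the good shifts form a closed subgroup of the line.

  The value of the limit comes from the identity that the convolution of \<open>U\<close> with the tail
  \<open>G s = P (X 1 > s)\<close> is the distribution function of the delay (\<open>nn_integral_tail_U\<close>), as one sees by
  decomposing at the last renewal up to time \<open>t\<close>. Smoothing it shows that \<open>\<integral> G s * f (t - s) ds\<close>
  tends to the integral of the trapezoid; as \<open>f\<close> is asymptotically invariant under shifts and \<open>G\<close>
  has integral \<open>\<mu>\<close>, the same integral is \<open>\<mu> * f t\<close> up to a vanishing error. The identity also bounds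
  \<open>U\<close> on windows.
\<close>

section \<open>Closed subgroups of the line and the support of a law\<close>

text \<open>
  If the subgroup has arbitrarily small positive elements, it is dense, hence everything; otherwise
  its least positive element generates it, by division with remainder.
\<close>
lemma closed_real_subgroup_cyclic:
  fixes H :: "real set"
  assumes "closed H" and zero: "0 \<in> H" and diff: "\<And>x y. x \<in> H \<Longrightarrow> y \<in> H \<Longrightarrow> x - y \<in> H"
    and "H \<noteq> UNIV"
  shows "\<exists>d>0. H \<subseteq> range (\<lambda>k::int. d * of_int k)"
proof -
  have uminus: "- x \<in> H" if "x \<in> H" for x
    using diff[OF zero that] by simp
  have add: "x + y \<in> H" if "x \<in> H" "y \<in> H" for x y
    using diff[OF that(1) uminus[OF that(2)]] by simp
  have nat_mult: "of_nat n * x \<in> H" if "x \<in> H" for n x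
    by (induction n) (auto simp: algebra_simps zero that intro: add)
  have int_mult: "of_int k * x \<in> H" if "x \<in> H" for k x
  proof (cases k)
    case (nonneg n)
    then show ?thesis using nat_mult[OF that, of n] by simp
  next
    case (neg n)
    then show ?thesis using uminus[OF nat_mult[OF that, of "Suc n"]]
      by (simp only: of_int_minus of_int_of_nat_eq minus_mult_left[symmetric])
  qed
  \<comment> \<open>Division with remainder by a positive element of the subgroup.\<close>
  have remainder: "0 \<le> x - of_int \<lfloor>x / g\<rfloor> * g \<and> x - of_int \<lfloor>x / g\<rfloor> * g < g" if "0 < g" for x g :: real
    using that floor_divide_lower[OF that, of x] floor_divide_upper[OF that, of x]
    by (simp add: distrib_right)
  \<comment> \<open>Multiples of a positive element below \<open>e\<close> come within \<open>e\<close> of every real.\<close>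
  have "\<not> (\<forall>e>0. \<exists>g\<in>H. 0 < g \<and> g < e)"
  proof
    assume small: "\<forall>e>0. \<exists>g\<in>H. 0 < g \<and> g < e"
    have "x \<in> closure H" for x
      unfolding closure_approachable
    proof (intro allI impI)
      fix e :: real assume "0 < e"
      then obtain g where g: "g \<in> H" "0 < g" "g < e" using small by blast
      show "\<exists>y\<in>H. dist y x < e"
        using int_mult[OF g(1), of "\<lfloor>x / g\<rfloor>"] remainder[OF g(2), of x] g(3)
        by (auto simp: dist_real_def intro!: bexI[of _ "of_int \<lfloor>x / g\<rfloor> * g"])
    qed
    with \<open>closed H\<close> \<open>H \<noteq> UNIV\<close> show False by (auto simp: closure_closed)
  qed
  then obtain e where e: "0 < e" "\<And>g. g \<in> H \<Longrightarrow> 0 < g \<Longrightarrow> e \<le> g" by force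
  \<comment> \<open>\<open>P\<close> is the set of positive elements, written so that it is closed and contains its infimum.\<close>
  define P where "P = H \<inter> {e..}"
  show ?thesis
  proof (cases "P = {}")
    case True
    have "x = 0" if "x \<in> H" for x
      using True e(2)[OF that] e(2)[OF uminus[OF that]] that uminus[OF that]
      unfolding P_def by (cases x "0::real" rule: linorder_cases) auto
    then have "H \<subseteq> range (\<lambda>k::int. 1 * of_int k)" by (auto intro: range_eqI[of _ _ 0])
    then show ?thesis by (intro exI[of _ 1]) simp
  next
    case False
    define d where "d = Inf P"
    have bdd: "bdd_below P" unfolding P_def by (rule bdd_belowI[of _ e]) auto
    have "d \<in> P" unfolding d_def using \<open>closed H\<close> False bdd
      by (intro closed_contains_Inf) (auto simp: P_def)
    then have d: "d \<in> H" "0 < d" using e(1) by (auto simp: P_def)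
    have "x = d * of_int \<lfloor>x / d\<rfloor>" if "x \<in> H" for x
    proof (rule ccontr)
      let ?y = "x - of_int \<lfloor>x / d\<rfloor> * d"
      assume "x \<noteq> d * of_int \<lfloor>x / d\<rfloor>"
      then have "0 < ?y" "?y < d" using remainder[OF d(2), of x] by (auto simp: mult.commute)
      moreover have "?y \<in> H" using diff[OF that int_mult[OF d(1)]] .
      ultimately have "?y \<in> P" using e(2)[of ?y] by (auto simp: P_def)
      then have "d \<le> ?y" unfolding d_def using bdd by (rule cInf_lower)
      with \<open>?y < d\<close> show False by simp
    qed
    then show ?thesis using d(2) by blast
  qed
qed

definition in_support :: "real measure \<Rightarrow> real \<Rightarrow> bool" where
  "in_support F a \<longleftrightarrow> (\<forall>r>0. 0 < measure F (ball a r))"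

text \<open>
  Otherwise every point of \<open>N\<close> has a null neighbourhood, and by the Lindelof property countably many
  of these cover \<open>N\<close>.
\<close>
lemma (in real_distribution) exists_in_support:
  assumes "open N" and "0 < prob N"
  shows "\<exists>a\<in>N. in_support M a"
proof (rule ccontr)
  assume "\<not> ?thesis"
  then have "\<exists>r>0. prob (ball a r) = 0" if "a \<in> N" for a
    using that by (auto simp: in_support_def zero_less_measure_iff)
  then obtain r where r: "\<And>a. a \<in> N \<Longrightarrow> 0 < r a \<and> prob (ball a (r a)) = 0" by metis
  obtain B where B: "B \<subseteq> (\<lambda>a. ball a (r a)) ` N" "countable B" "\<Union>B = (\<Union>a\<in>N. ball a (r a))"
    using Lindelof[of "(\<lambda>a. ball a (r a)) ` N"] by auto
  have "(\<Union>b\<in>B. b) \<in> null_sets M"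
    using B(1) r by (intro null_sets_UN' B(2)) (auto simp: emeasure_eq_measure intro!: null_setsI)
  moreover have "N \<subseteq> \<Union>B" unfolding B(3) using r by force
  ultimately have "N \<in> null_sets M"
    using \<open>open N\<close> by (auto intro: null_sets_subset)
  then show False using assms(2) by (simp add: measure_def null_setsD1)
qed

text \<open>
  A proper closed subgroup lies in a lattice; if it contained the support, the law would live on
  that lattice. This is the only way in which the nonarithmetic hypothesis enters.
\<close>
lemma (in real_distribution) nonarithmetic_support:
  assumes "nonarithmetic M" and "closed H" and "0 \<in> H"
    and "\<And>x y. x \<in> H \<Longrightarrow> y \<in> H \<Longrightarrow> x - y \<in> H"
    and supp: "\<And>a. in_support M a \<Longrightarrow> a \<in> H"
  shows "H = UNIV"
proof (rule ccontr)
  assume "H \<noteq> UNIV"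
  then obtain d where d: "d > 0" "H \<subseteq> range (\<lambda>k::int. d * of_int k)"
    using closed_real_subgroup_cyclic[of H] assms(2-4) by blast
  have "prob (- H) = 0"
    using exists_in_support[of "- H"] supp \<open>closed H\<close> by (auto simp: zero_less_measure_iff)
  then have "- H \<in> null_sets M"
    using \<open>closed H\<close> by (auto simp: emeasure_eq_measure intro!: null_setsI)
  then have "AE x in M. x \<in> H" by (rule AE_I') auto
  then have "AE x in M. x \<in> range (\<lambda>k::int. d * of_int k)" by eventually_elim (use d in auto)
  then show False using assms(1) d(1) by (auto simp: nonarithmetic_def)
qed

section \<open>Asymptotically harmonic functions\<close>

text \<open>
  A maximum principle at infinity. Along \<open>\<tau>\<close> the function nearly attains its limit superior
  \<open>\<eta>\<close>, and its value there is nearly the mean of the values \<open>\<phi> (\<tau> n - s)\<close>, none of which is much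
  larger than \<open>\<eta>\<close>. Hence these values tend to \<open>\<eta>\<close> in mean, and by uniform continuity also at
  every single point \<open>a\<close> that has mass in each of its neighbourhoods.
\<close>
lemma (in real_distribution) limsup_shift_by_support:
  fixes \<phi> :: "real \<Rightarrow> real" and \<tau> :: "nat \<Rightarrow> real"
  assumes uc: "uniformly_continuous_on UNIV \<phi>" and bdd: "\<And>t. \<bar>\<phi> t\<bar> \<le> B"
    and harm: "((\<lambda>t. \<phi> t - (\<integral>s. \<phi> (t - s) \<partial>M)) \<longlongrightarrow> 0) at_top"
    and upper: "\<And>e. 0 < e \<Longrightarrow> \<forall>\<^sub>F t in at_top. \<phi> t \<le> \<eta> + e"
    and \<tau>: "filterlim \<tau> at_top sequentially" and lim: "(\<lambda>n. \<phi> (\<tau> n)) \<longlonglongrightarrow> \<eta>"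
    and a: "in_support M a"
  shows "(\<lambda>n. \<phi> (\<tau> n - a)) \<longlonglongrightarrow> \<eta>"
proof -
  have [measurable]: "\<phi> \<in> borel_measurable borel"
    using uc by (intro borel_measurable_continuous_onI uniformly_continuous_imp_continuous)
  have int_\<phi>: "integrable M (\<lambda>s. \<phi> (t - s))" for t
    by (rule integrable_const_bound[of _ B]) (use bdd in auto)
  \<comment> \<open>The excess over \<open>\<eta>\<close>: it tends to zero in mean, and so controls the whole deviation from \<open>\<eta>\<close>.\<close>
  define neg where "neg n s = max 0 (\<phi> (\<tau> n - s) - \<eta>)" for n s
  have neg_bound: "\<bar>neg n s\<bar> \<le> B + \<bar>\<eta>\<bar>" for n s
    using bdd[of "\<tau> n - s"] by (auto simp: neg_def)
  have [measurable]: "neg n \<in> borel_measurable borel" for n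
    unfolding neg_def by measurable
  have int_neg: "integrable M (neg n)" for n
    by (rule integrable_const_bound[of _ "B + \<bar>\<eta>\<bar>"]) (use neg_bound in auto)
  have shift: "filterlim (\<lambda>n. \<tau> n - s) at_top sequentially" for s
    using filterlim_tendsto_add_at_top[OF tendsto_const[of "- s"] \<tau>] by simp
  have "(\<lambda>n. neg n s) \<longlonglongrightarrow> 0" for s
  proof (rule tendstoI)
    fix e :: real assume "0 < e"
    then have "\<forall>\<^sub>F n in sequentially. \<phi> (\<tau> n - s) \<le> \<eta> + e / 2"
      using upper[of "e / 2"] shift[of s] by (auto simp: filterlim_iff)
    then show "\<forall>\<^sub>F n in sequentially. dist (neg n s) 0 < e"
      by eventually_elim (use \<open>0 < e\<close> in \<open>auto simp: neg_def\<close>)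
  qed
  then have neg_lim: "(\<lambda>n. \<integral>s. neg n s \<partial>M) \<longlonglongrightarrow> (\<integral>s. 0 \<partial>M)"
    using neg_bound by (intro integral_dominated_convergence[where w="\<lambda>_. B + \<bar>\<eta>\<bar>"]) auto
  have "(\<lambda>n. \<integral>s. \<phi> (\<tau> n - s) \<partial>M) \<longlonglongrightarrow> \<eta> - 0"
    using tendsto_diff[OF lim filterlim_compose[OF harm \<tau>]] by simp
  then have "(\<lambda>n. 2 * (\<integral>s. neg n s \<partial>M) + (\<eta> - (\<integral>s. \<phi> (\<tau> n - s) \<partial>M))) \<longlonglongrightarrow> 2 * 0 + (\<eta> - (\<eta> - 0))"
    using neg_lim by (intro tendsto_intros) simp
  moreover have "2 * (\<integral>s. neg n s \<partial>M) + (\<eta> - (\<integral>s. \<phi> (\<tau> n - s) \<partial>M)) = (\<integral>s. \<bar>\<phi> (\<tau> n - s) - \<eta>\<bar> \<partial>M)" for n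
  proof -
    have "\<bar>\<phi> (\<tau> n - s) - \<eta>\<bar> = 2 * neg n s + (\<eta> - \<phi> (\<tau> n - s))" for s
      by (cases "\<eta> \<le> \<phi> (\<tau> n - s)") (simp_all add: neg_def)
    then show ?thesis using int_neg int_\<phi> by (simp add: prob_space[unfolded space_eq_univ])
  qed
  ultimately have L1: "(\<lambda>n. \<integral>s. \<bar>\<phi> (\<tau> n - s) - \<eta>\<bar> \<partial>M) \<longlonglongrightarrow> 0" by simp
  show ?thesis
  proof (rule tendstoI)
    fix e :: real assume "0 < e"
    then obtain r where r: "0 < r" "\<And>u v. dist u v < r \<Longrightarrow> dist (\<phi> u) (\<phi> v) < e / 2"
      using uc unfolding uniformly_continuous_on_def by (metis UNIV_I half_gt_zero)
    define p where "p = prob (ball a r)"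
    have "0 < p" using a r(1) by (simp add: in_support_def p_def)
    then have "\<forall>\<^sub>F n in sequentially. (\<integral>s. \<bar>\<phi> (\<tau> n - s) - \<eta>\<bar> \<partial>M) < p * (e / 2)"
      using L1 \<open>0 < e\<close> by (intro order_tendstoD(2)) auto
    then show "\<forall>\<^sub>F n in sequentially. dist (\<phi> (\<tau> n - a)) \<eta> < e"
    proof eventually_elim
      fix n assume n: "(\<integral>s. \<bar>\<phi> (\<tau> n - s) - \<eta>\<bar> \<partial>M) < p * (e / 2)"
      have "p * (\<bar>\<phi> (\<tau> n - a) - \<eta>\<bar> - e / 2) = (\<integral>s. (\<bar>\<phi> (\<tau> n - a) - \<eta>\<bar> - e / 2) * indicator (ball a r) s \<partial>M)"
        by (simp add: p_def)
      also have "\<dots> \<le> (\<integral>s. \<bar>\<phi> (\<tau> n - s) - \<eta>\<bar> \<partial>M)"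
      proof (rule integral_mono)
        show "integrable M (\<lambda>s. (\<bar>\<phi> (\<tau> n - a) - \<eta>\<bar> - e / 2) * indicator (ball a r) s)"
          by (intro integrable_mult_right integrable_real_indicator) (auto simp: emeasure_eq_measure)
        show "integrable M (\<lambda>s. \<bar>\<phi> (\<tau> n - s) - \<eta>\<bar>)" using int_\<phi> by simp
        fix s
        show "(\<bar>\<phi> (\<tau> n - a) - \<eta>\<bar> - e / 2) * indicator (ball a r) s \<le> \<bar>\<phi> (\<tau> n - s) - \<eta>\<bar>"
          using r(2)[of "\<tau> n - a" "\<tau> n - s"]
            dist_triangle2[of "\<phi> (\<tau> n - a)" \<eta> "\<phi> (\<tau> n - s)"]
          by (cases "s \<in> ball a r") (auto simp: dist_real_def abs_minus_commute)
      qed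
      also note n
      finally have "\<bar>\<phi> (\<tau> n - a) - \<eta>\<bar> - e / 2 < e / 2"
        using \<open>0 < p\<close> by simp
      then show "dist (\<phi> (\<tau> n - a)) \<eta> < e" by (simp add: dist_real_def)
    qed
  qed
qed

text \<open>
  The limit superior of a bounded function, with a sequence that realises it.
\<close>
lemma limsup_at_top_attained:
  fixes \<phi> :: "real \<Rightarrow> real"
  assumes bdd: "\<And>t. \<bar>\<phi> t\<bar> \<le> B"
  obtains \<eta> \<tau> where "\<forall>e>0. \<forall>\<^sub>F t in at_top. \<phi> t \<le> \<eta> + e"
    and "filterlim \<tau> at_top sequentially" and "(\<lambda>n. \<phi> (\<tau> n)) \<longlonglongrightarrow> \<eta>"
proof -
  define S where "S = {c. \<forall>\<^sub>F t in at_top. \<phi> t \<le> c}"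
  define \<eta> where "\<eta> = Inf S"
  have "B \<in> S" using bdd by (auto simp: S_def abs_le_iff)
  have below: "- B \<le> c" if "c \<in> S" for c
  proof -
    have "\<exists>t. \<phi> t \<le> c" using that by (intro eventually_happens'[of at_top]) (auto simp: S_def)
    then obtain t where "\<phi> t \<le> c" ..
    then show ?thesis using bdd[of t] by (auto simp: abs_le_iff)
  qed
  then have bddS: "bdd_below S" by (rule bdd_belowI)
  have upper: "\<forall>\<^sub>F t in at_top. \<phi> t \<le> \<eta> + e" if "0 < e" for e
  proof -
    obtain c where "c \<in> S" "c < \<eta> + e"
      using cInf_lessD[of S "\<eta> + e"] \<open>B \<in> S\<close> \<open>0 < e\<close> unfolding \<eta>_def by force
    then have "\<forall>\<^sub>F t in at_top. \<phi> t \<le> c" by (simp add: S_def)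
    then show ?thesis by eventually_elim (use \<open>c < \<eta> + e\<close> in auto)
  qed
  have "\<exists>t\<ge>real n. \<eta> - 1 / Suc n < \<phi> t" for n
  proof (rule ccontr)
    assume "\<not> ?thesis"
    then have "\<eta> - 1 / Suc n \<in> S"
      unfolding S_def eventually_at_top_linorder mem_Collect_eq not_less by (intro exI[of _ "real n"]) force
    then have "\<eta> \<le> \<eta> - 1 / Suc n" unfolding \<eta>_def using bddS by (rule cInf_lower)
    then show False by simp
  qed
  then obtain \<tau> where \<tau>: "\<And>n. real n \<le> \<tau> n" "\<And>n. \<eta> - 1 / Suc n < \<phi> (\<tau> n)" by metis
  have top: "filterlim \<tau> at_top sequentially"
    using filterlim_real_sequentially by (rule filterlim_at_top_mono) (use \<tau> in auto)
  have "(\<lambda>n. \<phi> (\<tau> n)) \<longlonglongrightarrow> \<eta>"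
  proof (rule order_tendstoI)
    fix c assume "c < \<eta>"
    have "(\<lambda>n. \<eta> - 1 / Suc n) \<longlonglongrightarrow> \<eta> - 0"
      by (intro tendsto_intros LIMSEQ_Suc lim_1_over_n)
    then have "\<forall>\<^sub>F n in sequentially. c < \<eta> - 1 / Suc n"
      using \<open>c < \<eta>\<close> by (intro order_tendstoD) auto
    then show "\<forall>\<^sub>F n in sequentially. c < \<phi> (\<tau> n)"
      by eventually_elim (use \<tau>(2) in \<open>auto intro: less_trans\<close>)
  next
    fix c assume "\<eta> < c"
    then have "\<forall>\<^sub>F n in sequentially. \<phi> (\<tau> n) \<le> \<eta> + (c - \<eta>) / 2"
      using upper[of "(c - \<eta>) / 2"] top by (auto simp: filterlim_iff)
    then show "\<forall>\<^sub>F n in sequentially. \<phi> (\<tau> n) < c"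
      by eventually_elim (use \<open>\<eta> < c\<close> in \<open>auto simp: field_simps\<close>)
  qed
  with upper top show ?thesis by (intro that) auto
qed

text \<open>
  Let \<open>\<eta>\<close> be the limit superior of the increment \<open>\<phi> t = f (t + a) - f t\<close>, which is asymptotically
  harmonic along with \<open>f\<close>. The maximum principle for \<open>\<phi>\<close> can be iterated, so \<open>\<phi>\<close> is close to \<open>\<eta>\<close>
  at \<open>k\<close> successive points with spacing \<open>a\<close>. The increments telescope to about \<open>k * \<eta>\<close>, which
  stays below \<open>2 * B\<close> for every \<open>k\<close> only if \<open>\<eta> \<le> 0\<close>.
\<close>
lemma (in real_distribution) increment_limsup_nonpos:
  fixes f :: "real \<Rightarrow> real"
  assumes uc: "uniformly_continuous_on UNIV f" and bdd: "\<And>t. \<bar>f t\<bar> \<le> B"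
    and harm: "((\<lambda>t. f t - (\<integral>s. f (t - s) \<partial>M)) \<longlongrightarrow> 0) at_top"
    and a: "in_support M a" and "0 < e"
  shows "\<forall>\<^sub>F t in at_top. f (t + a) - f t < e"
proof -
  have [measurable]: "f \<in> borel_measurable borel"
    using uc by (intro borel_measurable_continuous_onI uniformly_continuous_imp_continuous)
  have int_f: "integrable M (\<lambda>s. f (t - s))" for t
    by (rule integrable_const_bound[of _ B]) (use bdd in auto)
  define \<phi> where "\<phi> t = f (t + a) - f t" for t
  have bdd_\<phi>: "\<bar>\<phi> t\<bar> \<le> 2 * B" for t
    using bdd[of t] bdd[of "t + a"] by (auto simp: \<phi>_def)
  have uc_shift: "uniformly_continuous_on UNIV (\<lambda>t. f (t + a))"
    using uc unfolding uniformly_continuous_on_def dist_real_def by (metis UNIV_I add_diff_cancel_right)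
  have uc_\<phi>: "uniformly_continuous_on UNIV \<phi>"
    unfolding \<phi>_def by (intro uniformly_continuous_on_diff uc uc_shift)
  have "((\<lambda>t. f (t + a) - (\<integral>s. f (t + a - s) \<partial>M)) \<longlongrightarrow> 0) at_top"
    using filterlim_compose[OF harm filterlim_tendsto_add_at_top[OF tendsto_const[of a] filterlim_ident]]
    by (simp add: add.commute)
  from tendsto_diff[OF this harm]
  have harm_\<phi>: "((\<lambda>t. \<phi> t - (\<integral>s. \<phi> (t - s) \<partial>M)) \<longlongrightarrow> 0) at_top"
    using int_f by (simp add: \<phi>_def algebra_simps)
  obtain \<eta> \<tau> where upper: "\<forall>e>0. \<forall>\<^sub>F t in at_top. \<phi> t \<le> \<eta> + e"
    and \<tau>: "filterlim \<tau> at_top sequentially" and lim: "(\<lambda>n. \<phi> (\<tau> n)) \<longlonglongrightarrow> \<eta>"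
    by (rule limsup_at_top_attained[of \<phi>, OF bdd_\<phi>])
  have shift: "filterlim (\<lambda>n. \<tau> n - s) at_top sequentially" for s
    using filterlim_tendsto_add_at_top[OF tendsto_const[of "- s"] \<tau>] by simp
  have lim_k: "(\<lambda>n. \<phi> (\<tau> n - real k * a)) \<longlonglongrightarrow> \<eta>" for k
  proof (induction k)
    case (Suc k)
    then show ?case
      using limsup_shift_by_support[OF uc_\<phi> bdd_\<phi> harm_\<phi> upper[rule_format] shift Suc a]
      by (simp add: algebra_simps)
  qed (use lim in simp)
  have tele: "f (\<tau> n + a) - f (\<tau> n + a - real k * a) = (\<Sum>j<k. \<phi> (\<tau> n - real j * a))" for n k
    by (induction k) (simp_all add: \<phi>_def algebra_simps)
  have "real k * \<eta> \<le> 2 * B" for k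
  proof (rule LIMSEQ_le_const2)
    have "(\<lambda>n. \<Sum>j<k. \<phi> (\<tau> n - real j * a)) \<longlonglongrightarrow> (\<Sum>j<k. \<eta>)"
      by (intro tendsto_sum lim_k)
    then show "(\<lambda>n. f (\<tau> n + a) - f (\<tau> n + a - real k * a)) \<longlonglongrightarrow> real k * \<eta>"
      by (simp add: tele)
    show "\<exists>N. \<forall>n\<ge>N. f (\<tau> n + a) - f (\<tau> n + a - real k * a) \<le> 2 * B"
    proof (intro exI allI impI)
      fix n
      show "f (\<tau> n + a) - f (\<tau> n + a - real k * a) \<le> 2 * B"
        using bdd[of "\<tau> n + a"] bdd[of "\<tau> n + a - real k * a"] by (auto simp: abs_le_iff)
    qed
  qed
  then have "\<eta> \<le> 0"
    using ex_less_of_nat_mult[of \<eta> "2 * B"] by (force simp: not_less[symmetric])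
  have "\<forall>\<^sub>F t in at_top. \<phi> t \<le> \<eta> + e / 2" using upper \<open>0 < e\<close> by simp
  then show ?thesis
    by eventually_elim (use \<open>\<eta> \<le> 0\<close> \<open>0 < e\<close> in \<open>simp add: \<phi>_def\<close>)
qed

text \<open>
  The shifts \<open>h\<close> with this property form a subgroup, which is closed by uniform continuity and
  contains the support by the previous lemma, applied to \<open>f\<close> and to \<open>- f\<close>.
\<close>
lemma (in real_distribution) asymptotically_harmonic_increments_vanish:
  fixes f :: "real \<Rightarrow> real"
  assumes nonarith: "nonarithmetic M"
    and uc: "uniformly_continuous_on UNIV f" and bdd: "\<And>t. \<bar>f t\<bar> \<le> B"
    and harm: "((\<lambda>t. f t - (\<integral>s. f (t - s) \<partial>M)) \<longlongrightarrow> 0) at_top"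
  shows "((\<lambda>t. f (t + h) - f t) \<longlongrightarrow> 0) at_top"
proof -
  define H where "H = {h. ((\<lambda>t. f (t + h) - f t) \<longlongrightarrow> 0) at_top}"
  have shift: "filterlim (\<lambda>t. t + c) at_top at_top" for c :: real
    using filterlim_tendsto_add_at_top[OF tendsto_const[of c] filterlim_ident] by (simp add: add.commute)
  have diff: "x - y \<in> H" if "x \<in> H" "y \<in> H" for x y
  proof -
    have "((\<lambda>t. (f (t + - y + x) - f (t + - y)) - (f (t + - y + y) - f (t + - y))) \<longlongrightarrow> 0 - 0) at_top"
      by (intro tendsto_diff filterlim_compose[OF _ shift[of "-y"], of "\<lambda>t. f (t + x) - f t"]
          filterlim_compose[OF _ shift[of "-y"], of "\<lambda>t. f (t + y) - f t"])
        (use that in \<open>auto simp: H_def\<close>)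
    then show ?thesis by (simp add: H_def algebra_simps)
  qed
  have "closure H \<subseteq> H"
  proof
    fix x assume "x \<in> closure H"
    then have x: "\<forall>e>0. \<exists>y\<in>H. dist y x < e" by (simp add: closure_approachable)
    have "((\<lambda>t. f (t + x) - f t) \<longlongrightarrow> 0) at_top"
    proof (rule tendstoI)
      fix e :: real assume "0 < e"
      then obtain r where r: "0 < r" "\<And>u v. dist u v < r \<Longrightarrow> dist (f u) (f v) < e / 2"
        using uc unfolding uniformly_continuous_on_def by (metis UNIV_I half_gt_zero)
      obtain y where y: "y \<in> H" "dist y x < r" using x r(1) by blast
      then have "\<forall>\<^sub>F t in at_top. dist (f (t + y) - f t) 0 < e / 2"
        using \<open>0 < e\<close> by (intro tendstoD) (auto simp: H_def)
      then show "\<forall>\<^sub>F t in at_top. dist (f (t + x) - f t) 0 < e"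
      proof eventually_elim
        case (elim t)
        then show ?case using r(2)[of "t + y" "t + x"] y(2)
            dist_triangle_half_l[of "f (t + x)" "f (t + y)" e "f t"]
          by (simp add: dist_real_def abs_minus_commute)
      qed
    qed
    then show "x \<in> H" by (simp add: H_def)
  qed
  then have "closed H" by (metis closed_closure closure_subset subset_antisym)
  moreover have "a \<in> H" if a: "in_support M a" for a
  proof -
    have "\<forall>\<^sub>F t in at_top. f (t + a) - f t < e" if "0 < e" for e
      by (rule increment_limsup_nonpos[OF uc bdd harm a that])
    moreover have "\<forall>\<^sub>F t in at_top. - f (t + a) - - f t < e" if "0 < e" for e
    proof (rule increment_limsup_nonpos[of "\<lambda>t. - f t", OF _ _ _ a that])
      show "uniformly_continuous_on UNIV (\<lambda>t. - f t)" using uc by (rule uniformly_continuous_on_minus)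
      show "\<bar>- f t\<bar> \<le> B" for t using bdd by simp
      show "((\<lambda>t. - f t - (\<integral>s. - f (t - s) \<partial>M)) \<longlongrightarrow> 0) at_top"
        using tendsto_minus[OF harm] by simp
    qed
    ultimately have "\<forall>\<^sub>F t in at_top. f (t + a) - f t < e \<and> - f (t + a) - - f t < e" if "0 < e" for e
      using that by (intro eventually_conj) auto
    then have "((\<lambda>t. f (t + a) - f t) \<longlongrightarrow> 0) at_top"
      by (intro tendstoI) (auto simp: dist_real_def abs_less_iff elim: eventually_mono)
    then show ?thesis by (simp add: H_def)
  qed
  ultimately have "H = UNIV"
    using nonarithmetic_support[OF nonarith, of H] diff by (auto simp: H_def)
  then show ?thesis by (auto simp: H_def)
qed

section \<open>Trapezoidal kernels\<close>

text \<open>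
  For \<open>e \<le> w\<close> the trapezoid that is 1 on \<open>[-(w - e), w - e]\<close>, vanishes outside \<open>[-w, w]\<close> and
  is affine in between: a Lipschitz substitute for the indicator of an interval.
\<close>
definition plateau :: "real \<Rightarrow> real \<Rightarrow> real \<Rightarrow> real" where
  "plateau w e s = max 0 (min 1 ((w - \<bar>s\<bar>) / e))"

lemma plateau_nonneg [simp]: "0 \<le> plateau w e s"
  and plateau_le_1 [simp]: "plateau w e s \<le> 1"
  by (auto simp: plateau_def)

lemma plateau_measurable [measurable]: "plateau w e \<in> borel_measurable borel"
  unfolding plateau_def[abs_def] by measurable

lemma plateau_le_indicator: "0 < e \<Longrightarrow> plateau w e s \<le> indicator {-w<..<w} s"
  by (auto simp: plateau_def indicator_def field_simps)

lemma indicator_le_plateau: "0 < e \<Longrightarrow> indicator {-(w - e)..w - e} s \<le> plateau w e s"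
  by (auto simp: plateau_def indicator_def field_simps)

lemma plateau_eq_0: "0 < e \<Longrightarrow> w \<le> \<bar>s\<bar> \<Longrightarrow> plateau w e s = 0"
  by (auto simp: plateau_def field_simps max_def min_def)

lemma plateau_lipschitz:
  assumes "0 < e"
  shows "\<bar>plateau w e s - plateau w e s'\<bar> \<le> \<bar>s - s'\<bar> / e"
proof -
  have "\<bar>plateau w e s - plateau w e s'\<bar> \<le> \<bar>(w - \<bar>s\<bar>) / e - (w - \<bar>s'\<bar>) / e\<bar>"
    unfolding plateau_def by (simp add: max_def min_def)
  also have "\<dots> = \<bar>\<bar>s\<bar> - \<bar>s'\<bar>\<bar> / e"
    using assms by (simp add: diff_divide_distrib[symmetric] abs_minus_commute)
  also have "\<dots> \<le> \<bar>s - s'\<bar> / e"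
    using assms by (intro divide_right_mono abs_triangle_ineq3) auto
  finally show ?thesis .
qed

lemma integrable_plateau: "0 < e \<Longrightarrow> integrable lborel (plateau w e)"
  by (rule Bochner_Integration.integrable_bound[of _ "indicator {-w<..<w} :: real \<Rightarrow> real"])
    (auto simp: abs_of_nonneg intro!: plateau_le_indicator integrable_real_indicator emeasure_bounded_finite)

lemma integral_plateau_le: "0 < e \<Longrightarrow> 0 \<le> w \<Longrightarrow> (\<integral>s. plateau w e s \<partial>lborel) \<le> 2 * w"
  using integral_mono[OF integrable_plateau, of e "indicator {-w<..<w}" w]
  by (simp add: plateau_le_indicator)

lemma integral_plateau_ge: "0 < e \<Longrightarrow> 2 * (w - e) \<le> (\<integral>s. plateau w e s \<partial>lborel)"
proof (cases "e \<le> w")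
  case True
  assume "0 < e"
  have "(\<integral>s. indicator {-(w - e)..w - e} s \<partial>lborel) \<le> (\<integral>s. plateau w e s \<partial>lborel)"
    using \<open>0 < e\<close>
    by (intro integral_mono integrable_real_indicator integrable_plateau indicator_le_plateau
        emeasure_bounded_finite) auto
  then show ?thesis using True by simp
next
  case False
  then have "2 * (w - e) \<le> 0" by simp
  also have "0 \<le> (\<integral>s. plateau w e s \<partial>lborel)" by simp
  finally show ?thesis .
qed

section \<open>Blackwell's renewal theorem\<close>

text \<open>
  The renewal measure \<open>U\<close> with increment law \<open>F\<close> and delay law \<open>D\<close>, described by the equation
  \<open>U = D + U * F\<close> (convolution) instead of the series of convolution powers. The equation together
  with finiteness on half-lines carries the whole theory below.
\<close>
locale renewal_measure = F: real_distribution F + D: real_distribution D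
  for F D :: "real measure" +
  fixes U :: "real measure"
  assumes sets_U [simp, measurable_cong]: "sets U = sets borel"
    and renewal_equation: "\<And>g. g \<in> borel_measurable borel \<Longrightarrow>
      (\<integral>\<^sup>+x. g x \<partial>U) = (\<integral>\<^sup>+x. g x \<partial>D) + (\<integral>\<^sup>+x. \<integral>\<^sup>+y. g (x + y) \<partial>F \<partial>U)"
    and finite_atMost: "\<And>t. emeasure U {..t} < \<infinity>"
    and F_nonneg: "AE y in F. 0 \<le> y"
    and F_integrable: "integrable F (\<lambda>y. y)"
    and F_mean_pos: "0 < (\<integral>y. y \<partial>F)"
begin

lemma space_U [simp]: "space U = UNIV"
  using sets_eq_imp_space_eq[OF sets_U] by simp

text \<open>
  The cut at zero makes \<open>tail (t - x)\<close> vanish for renewals \<open>x\<close> after time \<open>t\<close>.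
\<close>
definition tail :: "real \<Rightarrow> real" where
  "tail s = indicator {0..} s * measure F {s<..}"

lemma tail_nonneg [simp]: "0 \<le> tail s"
  by (simp add: tail_def)

lemma measure_F_greaterThan: "measure F {s<..} = 1 - cdf F s"
  using F.prob_compl[of "{..s}"] by (simp add: cdf_def Compl_eq_Diff_UNIV[symmetric])

lemma tail_measurable [measurable]: "tail \<in> borel_measurable borel"
proof -
  have [measurable]: "cdf F \<in> borel_measurable borel"
    by (intro borel_measurable_mono monoI F.cdf_nondecreasing)
  show ?thesis unfolding tail_def[abs_def] measure_F_greaterThan by measurable
qed

lemma cdf_D_measurable [measurable]: "cdf D \<in> borel_measurable borel"
  by (intro borel_measurable_mono monoI D.cdf_nondecreasing)

text \<open>
  Both sides are the probability that a renewal occurs up to time \<open>t\<close>, the left one split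
  according to the last such renewal. Analytically, this is the renewal equation for the indicator
  of \<open>{..t}\<close>, with the finite quantity \<open>?A\<close> cancelled.
\<close>
lemma nn_integral_tail_U: "(\<integral>\<^sup>+x. ennreal (tail (t - x)) \<partial>U) = ennreal (cdf D t)"
proof -
  let ?A = "\<integral>\<^sup>+x. emeasure F {..t - x} \<partial>U"
  have [measurable]: "(\<lambda>x. emeasure F {..t - x}) \<in> borel_measurable borel"
  proof -
    have [measurable]: "cdf F \<in> borel_measurable borel"
      by (intro borel_measurable_mono monoI F.cdf_nondecreasing)
    have "emeasure F {..t - x} = ennreal (cdf F (t - x))" for x
      by (simp add: cdf_def F.emeasure_eq_measure)
    then show ?thesis by simp
  qed
  have "emeasure U {..t} = (\<integral>\<^sup>+x. indicator {..t} x \<partial>U)" by simp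
  also have "\<dots> = (\<integral>\<^sup>+x. indicator {..t} x \<partial>D) + (\<integral>\<^sup>+x. \<integral>\<^sup>+y. indicator {..t} (x + y) \<partial>F \<partial>U)"
    by (rule renewal_equation) simp
  also have "(\<integral>\<^sup>+x. \<integral>\<^sup>+y. indicator {..t} (x + y) \<partial>F \<partial>U) = ?A"
  proof (rule nn_integral_cong)
    fix x
    have "(\<integral>\<^sup>+y. indicator {..t} (x + y) \<partial>F) = (\<integral>\<^sup>+y. indicator {..t - x} y \<partial>F)"
      by (intro nn_integral_cong) (auto simp: indicator_def algebra_simps)
    then show "(\<integral>\<^sup>+y. indicator {..t} (x + y) \<partial>F) = emeasure F {..t - x}" by simp
  qed
  finally have eq1: "emeasure U {..t} = ennreal (cdf D t) + ?A"
    by (simp add: cdf_def D.emeasure_eq_measure)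
  have "indicator {..t} x = emeasure F {..t - x} + ennreal (tail (t - x))" for x
  proof (cases "x \<le> t")
    case True
    have "emeasure F {..t - x} + emeasure F {t - x<..} = emeasure F ({..t - x} \<union> {t - x<..})"
      by (rule plus_emeasure) auto
    also have "{..t - x} \<union> {t - x<..} = UNIV" by auto
    finally show ?thesis
      using True F.emeasure_space_1 by (simp add: tail_def F.emeasure_eq_measure)
  next
    case False
    have "AE y in F. \<not> y \<le> t - x" using F_nonneg by eventually_elim (use False in auto)
    then have "emeasure F {..t - x} = 0"
      by (subst (asm) AE_iff_measurable[of "{..t - x}"]) auto
    then show ?thesis using False by (simp add: tail_def)
  qed
  then have "(\<integral>\<^sup>+x. indicator {..t} x \<partial>U) = (\<integral>\<^sup>+x. emeasure F {..t - x} + ennreal (tail (t - x)) \<partial>U)"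
    by (intro nn_integral_cong) simp
  also have "\<dots> = ?A + (\<integral>\<^sup>+x. ennreal (tail (t - x)) \<partial>U)"
    by (rule nn_integral_add) auto
  finally have eq2: "emeasure U {..t} = ?A + (\<integral>\<^sup>+x. ennreal (tail (t - x)) \<partial>U)" by simp
  have "?A \<noteq> \<infinity>" using eq2 finite_atMost[of t] by auto
  then show ?thesis using eq1 eq2 by (simp add: add.commute ennreal_add_left_cancel)
qed

text \<open>
  Otherwise the increments vanish almost surely, against the positive mean.
\<close>
lemma exists_positive_step: "\<exists>\<delta>>0. 0 < measure F {\<delta><..}"
proof (rule ccontr)
  assume "\<not> ?thesis"
  then have zero: "measure F {1 / Suc n<..} = 0" for n
    by (auto simp: zero_less_measure_iff)
  have "AE y in F. \<forall>n. y \<le> 1 / Suc n"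
    unfolding AE_all_countable
  proof
    fix n
    have "{1 / Suc n<..} \<in> null_sets F" using zero[of n] by (intro null_setsI) (auto simp: F.emeasure_eq_measure)
    then show "AE y in F. y \<le> 1 / Suc n" by (rule AE_I') auto
  qed
  then have "AE y in F. y \<le> 0"
  proof eventually_elim
    case (elim y)
    show ?case
    proof (rule ccontr)
      assume "\<not> y \<le> 0"
      then obtain n where "inverse (Suc n) < y" using reals_Archimedean[of y] by auto
      with elim show False by (metis inverse_eq_divide not_less)
    qed
  qed
  then have "(\<integral>y. y \<partial>F) \<le> (\<integral>y. 0 \<partial>F)"
    using F_integrable by (intro integral_mono_AE) auto
  then show False using F_mean_pos by simp
qed

text \<open>
  A renewal in \<open>[t, t + \<delta>]\<close> is the last one up to \<open>t + \<delta>\<close> with probability at least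
  \<open>p = P(increment > \<delta>)\<close>, so the expected number of renewals there is at most \<open>1 / p\<close>; a longer
  window is covered by windows of length \<open>\<delta>\<close>.
\<close>
lemma window_bounded: "\<exists>C\<ge>0. \<forall>t. emeasure U {t..t + w} \<le> ennreal C"
proof -
  obtain \<delta> where \<delta>: "0 < \<delta>" "0 < measure F {\<delta><..}" using exists_positive_step by blast
  define p where "p = measure F {\<delta><..}"
  have "0 < p" using \<delta> by (simp add: p_def)
  have step: "emeasure U {t..t + \<delta>} \<le> ennreal (1 / p)" for t
  proof -
    have "ennreal p * emeasure U {t..t + \<delta>} = (\<integral>\<^sup>+x. ennreal p * indicator {t..t + \<delta>} x \<partial>U)"
      by (simp add: nn_integral_cmult_indicator)
    also have "\<dots> \<le> (\<integral>\<^sup>+x. ennreal (tail (t + \<delta> - x)) \<partial>U)"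
    proof (rule nn_integral_mono)
      fix x
      have "p \<le> measure F {t + \<delta> - x<..}" if "t \<le> x"
        unfolding p_def using that by (intro F.finite_measure_mono) auto
      then show "ennreal p * indicator {t..t + \<delta>} x \<le> ennreal (tail (t + \<delta> - x))"
        by (auto simp: tail_def indicator_def)
    qed
    also have "\<dots> \<le> 1" using D.cdf_bounded_prob by (simp add: nn_integral_tail_U)
    finally have "ennreal (1 / p) * (ennreal p * emeasure U {t..t + \<delta>}) \<le> ennreal (1 / p) * 1"
      by (intro mult_left_mono) auto
    then show ?thesis
      using \<open>0 < p\<close> by (simp add: mult.assoc[symmetric] ennreal_mult[symmetric])
  qed
  have steps: "emeasure U {t..t + real n * \<delta>} \<le> ennreal (real (Suc n) * (1 / p))" for t n
  proof (induction n)
    case 0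
    have "emeasure U {t..t + real 0 * \<delta>} \<le> emeasure U {t..t + \<delta>}"
      using \<delta> by (intro emeasure_mono) auto
    then show ?case using step[of t] by simp
  next
    case (Suc n)
    have "emeasure U {t..t + real (Suc n) * \<delta>}
        \<le> emeasure U ({t..t + real n * \<delta>} \<union> {t + real n * \<delta>..t + real n * \<delta> + \<delta>})"
      by (intro emeasure_mono) (auto simp: algebra_simps)
    also have "\<dots> \<le> emeasure U {t..t + real n * \<delta>} + emeasure U {t + real n * \<delta>..t + real n * \<delta> + \<delta>}"
      by (rule emeasure_subadditive) auto
    also have "\<dots> \<le> ennreal (real (Suc n) * (1 / p)) + ennreal (1 / p)"
      by (intro add_mono Suc.IH step)
    also have "\<dots> = ennreal (real (Suc (Suc n)) * (1 / p))"
      using \<open>0 < p\<close> by (simp add: ennreal_plus[symmetric] algebra_simps add_divide_distrib del: ennreal_plus)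
    finally show ?case .
  qed
  obtain n where "w < real n * \<delta>" using reals_Archimedean3[OF \<delta>(1)] by blast
  then have "emeasure U {t..t + w} \<le> ennreal (real (Suc n) * (1 / p))" for t
    by (intro order_trans[OF emeasure_mono steps[of t n]]) auto
  then show ?thesis using \<open>0 < p\<close> by (intro exI[of _ "real (Suc n) * (1 / p)"]) auto
qed

lemma emeasure_U_bounded: "bounded B \<Longrightarrow> emeasure U B < \<infinity>"
proof -
  assume "bounded B"
  then obtain a where "B \<subseteq> {..a}" by (auto simp: bounded_real abs_le_iff)
  then have "emeasure U B \<le> emeasure U {..a}" by (intro emeasure_mono) auto
  then show ?thesis using finite_atMost[of a] by (rule le_less_trans)
qed

lemma sigma_finite_U: "sigma_finite_measure U"
proof (unfold_locales, intro exI conjI)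
  show "countable (range (\<lambda>n::nat. {..real n}))" by simp
  show "\<Union> (range (\<lambda>n::nat. {..real n})) = space U"
    by (auto intro: real_arch_simple)
  show "\<forall>a\<in>range (\<lambda>n::nat. {..real n}). emeasure U a \<noteq> \<infinity>"
    using finite_atMost by (auto simp: less_top[symmetric])
qed auto

sublocale U: sigma_finite_measure U by (rule sigma_finite_U)
sublocale UF: pair_sigma_finite U F ..
sublocale Leb_U: pair_sigma_finite lborel U ..
sublocale Leb_F: pair_sigma_finite lborel F ..

lemma window_measurable [measurable]: "(\<lambda>t. measure U {t<..t + x}) \<in> borel_measurable borel"
proof -
  have "(\<lambda>t. \<integral>\<^sup>+y. (if t < y \<and> y \<le> t + x then 1 else 0) \<partial>U) \<in> borel_measurable borel"
    by measurable
  also have "(\<lambda>t. \<integral>\<^sup>+y. (if t < y \<and> y \<le> t + x then 1 else 0) \<partial>U)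
      = (\<lambda>t. \<integral>\<^sup>+y. indicator {t<..t + x} y \<partial>U)"
    by (auto simp: indicator_def intro!: ext nn_integral_cong)
  also have "\<dots> = (\<lambda>t. emeasure U {t<..t + x})" by simp
  finally show ?thesis unfolding measure_def by measurable
qed

lemma tail_has_mean: "integrable lborel tail" "(\<integral>s. tail s \<partial>lborel) = (\<integral>y. y \<partial>F)"
proof -
  have "(\<integral>\<^sup>+s. ennreal (tail s) \<partial>lborel) = (\<integral>\<^sup>+s. \<integral>\<^sup>+y. indicator {0..<y} s \<partial>F \<partial>lborel)"
  proof (rule nn_integral_cong)
    fix s
    have "(\<integral>\<^sup>+y. indicator {0..<y} s \<partial>F) = (\<integral>\<^sup>+y. indicator {0..} s * indicator {s<..} y \<partial>F)"
      by (intro nn_integral_cong) (auto simp: indicator_def)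
    also have "\<dots> = ennreal (tail s)"
      by (subst nn_integral_cmult_indicator)
        (auto simp: tail_def F.emeasure_eq_measure indicator_def)
    finally show "ennreal (tail s) = (\<integral>\<^sup>+y. indicator {0..<y} s \<partial>F)" ..
  qed
  also have "\<dots> = (\<integral>\<^sup>+y. \<integral>\<^sup>+s. indicator {0..<y} s \<partial>lborel \<partial>F)"
  proof (rule Leb_F.Fubini'[symmetric])
    have eq: "(\<lambda>(s, y). indicator {0..<y} s :: ennreal) = (\<lambda>z. if 0 \<le> fst z \<and> fst z < snd z then 1 else 0)"
      by (auto simp: indicator_def fun_eq_iff)
    show "(\<lambda>(s, y). indicator {0..<y} s :: ennreal) \<in> borel_measurable (lborel \<Otimes>\<^sub>M F)"
      unfolding eq by measurable
  qed
  also have "\<dots> = (\<integral>\<^sup>+y. ennreal y \<partial>F)"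
    using F_nonneg by (intro nn_integral_cong_AE) (auto elim!: eventually_mono)
  also have "\<dots> = ennreal (\<integral>y. y \<partial>F)"
    using F_integrable F_nonneg by (intro nn_integral_eq_integral) auto
  finally have nn: "(\<integral>\<^sup>+s. ennreal (tail s) \<partial>lborel) = ennreal (\<integral>y. y \<partial>F)" .
  then show int: "integrable lborel tail"
    by (intro integrableI_nonneg) auto
  from nn show "(\<integral>s. tail s \<partial>lborel) = (\<integral>y. y \<partial>F)"
    using F_mean_pos by (intro integral_eq_nn_integral[THEN trans]) auto
qed

definition smoothed :: "real \<Rightarrow> real \<Rightarrow> real \<Rightarrow> real" where
  "smoothed w e t = (\<integral>y. plateau w e (t - y) \<partial>U)"

context
  fixes w e :: real
  assumes e: "0 < e" and w: "0 < w"
begin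

lemma integrable_shifted_plateau: "integrable U (\<lambda>y. plateau w e (t - y))"
proof (rule Bochner_Integration.integrable_bound)
  show "integrable U (indicator {t - w..t + w} :: real \<Rightarrow> real)"
    using emeasure_U_bounded[of "{t - w..t + w}"] by (intro integrable_real_indicator) auto
  show "AE y in U. norm (plateau w e (t - y)) \<le> norm (indicator {t - w..t + w} y :: real)"
  proof (rule AE_I2)
    fix y
    show "norm (plateau w e (t - y)) \<le> norm (indicator {t - w..t + w} y :: real)"
      using plateau_eq_0[OF e, of w "t - y"] by (cases "y \<in> {t - w..t + w}") auto
  qed
qed simp

lemma smoothed_nonneg: "0 \<le> smoothed w e t"
  by (simp add: smoothed_def)

lemma nn_integral_plateau_U: "(\<integral>\<^sup>+y. ennreal (plateau w e (t - y)) \<partial>U) = ennreal (smoothed w e t)"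
  unfolding smoothed_def by (rule nn_integral_eq_integral) (auto intro: integrable_shifted_plateau)

lemma smoothed_measurable [measurable]: "smoothed w e \<in> borel_measurable borel"
  unfolding smoothed_def[abs_def] by measurable

lemma smoothed_bounded: "\<exists>C. \<forall>t. \<bar>smoothed w e t\<bar> \<le> C"
proof -
  obtain C where C: "0 \<le> C" "\<And>t. emeasure U {t..t + 2 * w} \<le> ennreal C"
    using window_bounded[of "2 * w"] by blast
  have "smoothed w e t \<le> C" for t
  proof -
    have "ennreal (smoothed w e t) \<le> (\<integral>\<^sup>+y. indicator {t - w..t - w + 2 * w} y \<partial>U)"
      unfolding nn_integral_plateau_U[symmetric]
    proof (rule nn_integral_mono)
      fix y
      show "ennreal (plateau w e (t - y)) \<le> indicator {t - w..t - w + 2 * w} y"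
        using plateau_eq_0[OF e, of w "t - y"] by (cases "y \<in> {t - w..t + w}") auto
    qed
    also have "\<dots> = emeasure U {t - w..t - w + 2 * w}" by simp
    also note C(2)[of "t - w"]
    finally show ?thesis using C(1) by simp
  qed
  then show ?thesis using smoothed_nonneg by (auto intro!: exI[of _ C])
qed

lemma smoothed_uniformly_continuous: "uniformly_continuous_on UNIV (smoothed w e)"
proof -
  obtain C where C: "0 \<le> C" "\<And>t. emeasure U {t..t + (2 * w + 2)} \<le> ennreal C"
    using window_bounded[of "2 * w + 2"] by blast
  have lip: "\<bar>smoothed w e t - smoothed w e t'\<bar> \<le> \<bar>t - t'\<bar> / e * C" if "\<bar>t - t'\<bar> \<le> 1" for t t'
  proof -
    let ?W = "{t - w - 1..t - w - 1 + (2 * w + 2)}"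
    have meas: "measure U ?W \<le> C"
      using C(2)[of "t - w - 1"] C(1) by (simp add: measure_def enn2real_leI)
    have intW: "integrable U (indicator ?W :: real \<Rightarrow> real)"
      using emeasure_U_bounded[of ?W] by (intro integrable_real_indicator) auto
    have "\<bar>smoothed w e t - smoothed w e t'\<bar>
        = \<bar>\<integral>y. plateau w e (t - y) - plateau w e (t' - y) \<partial>U\<bar>"
      by (simp add: smoothed_def integrable_shifted_plateau)
    also have "\<dots> \<le> (\<integral>y. \<bar>plateau w e (t - y) - plateau w e (t' - y)\<bar> \<partial>U)"
      by (rule integral_abs_bound)
    also have "\<dots> \<le> (\<integral>y. \<bar>t - t'\<bar> / e * indicator ?W y \<partial>U)"
    proof (rule integral_mono)
      show "integrable U (\<lambda>y. \<bar>plateau w e (t - y) - plateau w e (t' - y)\<bar>)"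
        by (intro integrable_abs Bochner_Integration.integrable_diff integrable_shifted_plateau)
      show "integrable U (\<lambda>y. \<bar>t - t'\<bar> / e * indicator ?W y)"
        using intW by (rule integrable_mult_right)
      fix y
      show "\<bar>plateau w e (t - y) - plateau w e (t' - y)\<bar> \<le> \<bar>t - t'\<bar> / e * indicator ?W y"
      proof (cases "y \<in> ?W")
        case True
        then show ?thesis using plateau_lipschitz[OF e, of w "t - y" "t' - y"] by simp
      next
        case False
        then have "w \<le> \<bar>t - y\<bar>" "w \<le> \<bar>t' - y\<bar>" using that by auto
        then show ?thesis using e by (simp add: plateau_eq_0)
      qed
    qed
    also have "\<dots> = \<bar>t - t'\<bar> / e * measure U ?W" by simp
    also have "\<dots> \<le> \<bar>t - t'\<bar> / e * C" using meas e by (intro mult_left_mono) auto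
    finally show ?thesis .
  qed
  show ?thesis
    unfolding uniformly_continuous_on_def
  proof (intro allI impI)
    fix r :: real assume "0 < r"
    define d where "d = min 1 (r * e / (C + 1))"
    have "0 < d" using \<open>0 < r\<close> e C(1) by (simp add: d_def)
    moreover have "dist (smoothed w e t') (smoothed w e t) < r" if "dist t' t < d" for t t'
    proof -
      have "\<bar>smoothed w e t' - smoothed w e t\<bar> \<le> \<bar>t' - t\<bar> / e * C"
        using that by (intro lip) (simp add: d_def dist_real_def)
      also have "\<dots> \<le> \<bar>t' - t\<bar> / e * (C + 1)" using e by (intro mult_left_mono) auto
      also have "\<dots> < r" using that e C(1) by (simp add: d_def dist_real_def field_simps)
      finally show ?thesis by (simp add: dist_real_def)
    qed
    ultimately show "\<exists>d>0. \<forall>x\<in>UNIV. \<forall>x'\<in>UNIV. dist x' x < d \<longrightarrow> dist (smoothed w e x') (smoothed w e x) < r"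
      by blast
  qed
qed

lemma smoothed_renewal_equation:
  "smoothed w e t - (\<integral>s. smoothed w e (t - s) \<partial>F) = (\<integral>y. plateau w e (t - y) \<partial>D)"
proof -
  obtain C where C: "\<And>t. \<bar>smoothed w e t\<bar> \<le> C" using smoothed_bounded by blast
  have intF: "integrable F (\<lambda>s. smoothed w e (t - s))"
    by (rule F.integrable_const_bound[of _ C]) (use C in auto)
  have intD: "integrable D (\<lambda>y. plateau w e (t - y))"
    by (rule D.integrable_const_bound[of _ 1]) auto
  have "ennreal (smoothed w e t) = (\<integral>\<^sup>+x. ennreal (plateau w e (t - x)) \<partial>D)
      + (\<integral>\<^sup>+x. \<integral>\<^sup>+y. ennreal (plateau w e (t - (x + y))) \<partial>F \<partial>U)"
    unfolding nn_integral_plateau_U[symmetric] by (rule renewal_equation) measurable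
  also have "(\<integral>\<^sup>+x. \<integral>\<^sup>+y. ennreal (plateau w e (t - (x + y))) \<partial>F \<partial>U)
      = (\<integral>\<^sup>+y. \<integral>\<^sup>+x. ennreal (plateau w e (t - y - x)) \<partial>U \<partial>F)"
    by (subst UF.Fubini'[symmetric]) (simp_all add: algebra_simps)
  also have "\<dots> = ennreal (\<integral>s. smoothed w e (t - s) \<partial>F)"
    unfolding nn_integral_plateau_U
    by (rule nn_integral_eq_integral[OF intF]) (simp add: smoothed_nonneg)
  also have "(\<integral>\<^sup>+x. ennreal (plateau w e (t - x)) \<partial>D) = ennreal (\<integral>y. plateau w e (t - y) \<partial>D)"
    by (rule nn_integral_eq_integral[OF intD]) simp
  finally have "ennreal (smoothed w e t)
      = ennreal ((\<integral>y. plateau w e (t - y) \<partial>D) + (\<integral>s. smoothed w e (t - s) \<partial>F))"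
    by (simp add: smoothed_nonneg)
  then show ?thesis
    by (subst (asm) ennreal_inj) (auto simp: smoothed_nonneg intro!: add_nonneg_nonneg)
qed

text \<open>
  The defect of harmonicity is the mean of the kernel under the delay law, and the kernel moves off
  to infinity.
\<close>
lemma smoothed_increments_vanish:
  assumes "nonarithmetic F"
  shows "((\<lambda>t. smoothed w e (t + h) - smoothed w e t) \<longlongrightarrow> 0) at_top"
proof -
  obtain C where C: "\<And>t. \<bar>smoothed w e t\<bar> \<le> C" using smoothed_bounded by blast
  have "((\<lambda>t. \<integral>y. plateau w e (t - y) \<partial>D) \<longlongrightarrow> (\<integral>y. 0 \<partial>D)) at_top"
  proof (rule integral_dominated_convergence_at_top[where w="\<lambda>_. 1"])
    show "AE y in D. ((\<lambda>t. plateau w e (t - y)) \<longlongrightarrow> 0) at_top"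
    proof (rule AE_I2)
      fix y
      have "\<forall>\<^sub>F t in at_top. plateau w e (t - y) = 0"
        using eventually_ge_at_top[of "y + w"]
      proof eventually_elim
        case (elim t)
        then show ?case by (intro plateau_eq_0[OF e]) auto
      qed
      then show "((\<lambda>t. plateau w e (t - y)) \<longlongrightarrow> 0) at_top" by (rule tendsto_eventually)
    qed
  qed auto
  then have "((\<lambda>t. smoothed w e t - (\<integral>s. smoothed w e (t - s) \<partial>F)) \<longlongrightarrow> 0) at_top"
    by (simp add: smoothed_renewal_equation)
  then show ?thesis
    by (rule F.asymptotically_harmonic_increments_vanish[OF assms smoothed_uniformly_continuous C])
qed

text \<open>
  Convolution is associative: smoothing after convolving \<open>U\<close> with the tail smooths the function
  \<open>cdf D\<close>.
\<close>
lemma tail_convolution_smoothed: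
  "(\<integral>s. tail s * smoothed w e (t - s) \<partial>lborel) = (\<integral>s. plateau w e s * cdf D (t - s) \<partial>lborel)"
proof -
  have "(\<integral>\<^sup>+s. ennreal (tail s * smoothed w e (t - s)) \<partial>lborel)
      = (\<integral>\<^sup>+s. \<integral>\<^sup>+y. ennreal (tail s) * ennreal (plateau w e (t - s - y)) \<partial>U \<partial>lborel)"
    by (subst nn_integral_cmult) (simp_all add: nn_integral_plateau_U ennreal_mult smoothed_nonneg)
  also have "\<dots> = (\<integral>\<^sup>+y. \<integral>\<^sup>+s. ennreal (tail s) * ennreal (plateau w e (t - s - y)) \<partial>lborel \<partial>U)"
    by (subst Leb_U.Fubini') (auto simp: split_beta')
  also have "\<dots> = (\<integral>\<^sup>+y. \<integral>\<^sup>+s. ennreal (tail (t - s - y)) * ennreal (plateau w e s) \<partial>lborel \<partial>U)"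
  proof (rule nn_integral_cong)
    fix y
    show "(\<integral>\<^sup>+s. ennreal (tail s) * ennreal (plateau w e (t - s - y)) \<partial>lborel)
        = (\<integral>\<^sup>+s. ennreal (tail (t - s - y)) * ennreal (plateau w e s) \<partial>lborel)"
      by (subst nn_integral_real_affine[where c="-1" and t="t - y"]) (auto simp: algebra_simps)
  qed
  also have "\<dots> = (\<integral>\<^sup>+s. \<integral>\<^sup>+y. ennreal (tail (t - s - y)) * ennreal (plateau w e s) \<partial>U \<partial>lborel)"
    by (subst Leb_U.Fubini') (auto simp: split_beta')
  also have "\<dots> = (\<integral>\<^sup>+s. ennreal (plateau w e s * cdf D (t - s)) \<partial>lborel)"
    by (subst nn_integral_multc) (simp_all add: nn_integral_tail_U ennreal_mult D.cdf_nonneg mult.commute)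
  finally show ?thesis
    by (subst (1 2) integral_eq_nn_integral) (auto simp: smoothed_nonneg D.cdf_nonneg)
qed

text \<open>
  In \<open>\<integral> tail s * smoothed w e (t - s) ds\<close> the argument \<open>t - s\<close> may be replaced by \<open>t\<close> in the limit,
  because increments of \<open>smoothed\<close> vanish; this leaves the mean times \<open>smoothed w e t\<close>. By the
  previous lemma the same integral tends to the integral of the kernel. So convergence and
  the value of the limit come out together.
\<close>
lemma smoothed_limit:
  assumes "nonarithmetic F"
  shows "(smoothed w e \<longlongrightarrow> (\<integral>s. plateau w e s \<partial>lborel) / (\<integral>y. y \<partial>F)) at_top"
proof -
  let ?\<mu> = "\<integral>y. y \<partial>F"
  obtain C where C: "\<And>t. \<bar>smoothed w e t\<bar> \<le> C" using smoothed_bounded by blast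
  have int: "integrable lborel (\<lambda>s. tail s * smoothed w e (t - s))" for t
  proof (rule Bochner_Integration.integrable_bound)
    show "integrable lborel (\<lambda>s. C * tail s)" using tail_has_mean(1) by simp
    show "AE s in lborel. norm (tail s * smoothed w e (t - s)) \<le> norm (C * tail s)"
    proof (rule AE_I2)
      fix s
      show "norm (tail s * smoothed w e (t - s)) \<le> norm (C * tail s)"
        using mult_left_mono[OF order_trans[OF C abs_ge_self] tail_nonneg, of s "t - s"]
        by (simp add: abs_mult mult.commute)
    qed
  qed simp
  have int': "integrable lborel (\<lambda>s. tail s * smoothed w e t)" for t
    using tail_has_mean(1) by simp
  have "((\<lambda>t. \<integral>s. tail s * (smoothed w e (t - s) - smoothed w e t) \<partial>lborel) \<longlongrightarrow> (\<integral>s. 0 \<partial>(lborel :: real measure))) at_top"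
  proof (rule integral_dominated_convergence_at_top[where w="\<lambda>s. 2 * C * tail s"])
    show "integrable lborel (\<lambda>s. 2 * C * tail s)" using tail_has_mean(1) by simp
    show "AE s in lborel. ((\<lambda>t. tail s * (smoothed w e (t - s) - smoothed w e t)) \<longlongrightarrow> 0) at_top"
    proof (rule AE_I2)
      fix s
      show "((\<lambda>t. tail s * (smoothed w e (t - s) - smoothed w e t)) \<longlongrightarrow> 0) at_top"
        using tendsto_mult_right_zero[OF smoothed_increments_vanish[OF assms, of "- s"], of "tail s"] by simp
    qed
    show "\<forall>\<^sub>F t in at_top. AE s in lborel. norm (tail s * (smoothed w e (t - s) - smoothed w e t)) \<le> 2 * C * tail s"
    proof (intro always_eventually allI AE_I2)
      fix t s
      have "\<bar>smoothed w e (t - s) - smoothed w e t\<bar> \<le> 2 * C"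
        using C[of "t - s"] C[of t] by (simp add: abs_le_iff)
      from mult_left_mono[OF this tail_nonneg[of s]]
      show "norm (tail s * (smoothed w e (t - s) - smoothed w e t)) \<le> 2 * C * tail s"
        by (simp add: abs_mult mult.commute)
    qed
  qed auto
  moreover have "((\<lambda>t. \<integral>s. plateau w e s * cdf D (t - s) \<partial>lborel) \<longlongrightarrow> (\<integral>s. plateau w e s \<partial>lborel)) at_top"
  proof (rule integral_dominated_convergence_at_top[where w="plateau w e"])
    show "integrable lborel (plateau w e)" by (rule integrable_plateau[OF e])
    show "AE s in lborel. ((\<lambda>t. plateau w e s * cdf D (t - s)) \<longlongrightarrow> plateau w e s) at_top"
    proof (rule AE_I2)
      fix s :: real
      have "filterlim (\<lambda>t. t - s) at_top at_top"
        using filterlim_tendsto_add_at_top[OF tendsto_const[of "- s"] filterlim_ident] by simp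
      from filterlim_compose[OF D.cdf_lim_at_top_prob this]
      show "((\<lambda>t. plateau w e s * cdf D (t - s)) \<longlongrightarrow> plateau w e s) at_top"
        using tendsto_mult_left[of "\<lambda>t. cdf D (t - s)" 1 at_top "plateau w e s"] by simp
    qed
    show "\<forall>\<^sub>F t in at_top. AE s in lborel. norm (plateau w e s * cdf D (t - s)) \<le> plateau w e s"
      by (intro always_eventually allI AE_I2)
        (simp add: abs_mult D.cdf_nonneg mult_left_le D.cdf_bounded_prob)
  qed auto
  ultimately have "((\<lambda>t. ((\<integral>s. plateau w e s * cdf D (t - s) \<partial>lborel)
      - (\<integral>s. tail s * (smoothed w e (t - s) - smoothed w e t) \<partial>lborel)) / ?\<mu>)
      \<longlongrightarrow> ((\<integral>s. plateau w e s \<partial>lborel) - 0) / ?\<mu>) at_top"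
    using F_mean_pos by (intro tendsto_intros) auto
  moreover have "(\<integral>s. tail s * (smoothed w e (t - s) - smoothed w e t) \<partial>lborel)
      = (\<integral>s. plateau w e s * cdf D (t - s) \<partial>lborel) - ?\<mu> * smoothed w e t" for t
    using int int' by (simp add: right_diff_distrib tail_convolution_smoothed tail_has_mean(2))
  ultimately show ?thesis using F_mean_pos by simp
qed

end

text \<open>
  The indicator of \<open>{t<..t + x}\<close> is squeezed between two trapezoids centred at \<open>t + x / 2\<close>, whose
  integrals differ from \<open>x\<close> by at most \<open>2 * e\<close>.
\<close>
theorem blackwell:
  assumes "nonarithmetic F" and "0 < x"
  shows "((\<lambda>t. measure U {t<..t + x}) \<longlongrightarrow> x / (\<integral>y. y \<partial>F)) at_top"
proof (rule order_tendstoI)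
  let ?\<mu> = "\<integral>y. y \<partial>F"
  have shift: "filterlim (\<lambda>t. t + x / 2) at_top at_top"
    using filterlim_tendsto_add_at_top[OF tendsto_const[of "x / 2"] filterlim_ident] by (simp add: add.commute)
  have lim: "((\<lambda>t. smoothed w e (t + x / 2)) \<longlongrightarrow> (\<integral>s. plateau w e s \<partial>lborel) / ?\<mu>) at_top"
    if "0 < e" "0 < w" for w e
    using filterlim_compose[OF smoothed_limit[OF that assms(1)] shift] .
  have int: "integrable U (indicator {t<..t + x} :: real \<Rightarrow> real)" for t
    using emeasure_U_bounded[of "{t<..t + x}"] by (intro integrable_real_indicator) auto
  {
    fix a assume a: "a < x / ?\<mu>"
    \<comment> \<open>Any \<open>e\<close> below half of \<open>x - a * ?\<mu>\<close> would do.\<close>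
    define e where "e = (x - a * ?\<mu>) / 4"
    have "0 < e" using a F_mean_pos by (simp add: e_def field_simps)
    have "a * ?\<mu> < x - 2 * e" using \<open>0 < e\<close> by (simp add: e_def field_simps)
    also have "\<dots> \<le> (\<integral>s. plateau (x / 2) e s \<partial>lborel)"
      using integral_plateau_ge[OF \<open>0 < e\<close>, of "x / 2"] by simp
    finally have "a < (\<integral>s. plateau (x / 2) e s \<partial>lborel) / ?\<mu>"
      using F_mean_pos by (simp add: field_simps)
    then have "\<forall>\<^sub>F t in at_top. a < smoothed (x / 2) e (t + x / 2)"
      using lim[OF \<open>0 < e\<close>, of "x / 2"] \<open>0 < x\<close> by (intro order_tendstoD) auto
    then show "\<forall>\<^sub>F t in at_top. a < measure U {t<..t + x}"
    proof eventually_elim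
      case (elim t)
      have "smoothed (x / 2) e (t + x / 2) \<le> (\<integral>y. indicator {t<..t + x} y \<partial>U)"
        unfolding smoothed_def
      proof (rule integral_mono[OF _ int])
        show "integrable U (\<lambda>y. plateau (x / 2) e (t + x / 2 - y))"
          using \<open>0 < e\<close> \<open>0 < x\<close> by (intro integrable_shifted_plateau) auto
        fix y
        show "plateau (x / 2) e (t + x / 2 - y) \<le> indicator {t<..t + x} y"
          using plateau_le_indicator[OF \<open>0 < e\<close>, of "x / 2" "t + x / 2 - y"]
          by (auto simp: indicator_def split: if_splits)
      qed
      with elim show ?case by simp
    qed
  next
    fix a assume a: "x / ?\<mu> < a"
    define e where "e = (a * ?\<mu> - x) / 4"
    have "0 < e" using a F_mean_pos by (simp add: e_def field_simps)
    have "(\<integral>s. plateau (x / 2 + e) e s \<partial>lborel) \<le> x + 2 * e"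
      using integral_plateau_le[OF \<open>0 < e\<close>, of "x / 2 + e"] \<open>0 < e\<close> \<open>0 < x\<close> by simp
    also have "\<dots> < a * ?\<mu>" using \<open>0 < e\<close> by (simp add: e_def field_simps)
    finally have "(\<integral>s. plateau (x / 2 + e) e s \<partial>lborel) / ?\<mu> < a"
      using F_mean_pos by (simp add: field_simps)
    then have "\<forall>\<^sub>F t in at_top. smoothed (x / 2 + e) e (t + x / 2) < a"
      using lim[OF \<open>0 < e\<close>, of "x / 2 + e"] \<open>0 < x\<close> \<open>0 < e\<close> by (intro order_tendstoD) auto
    then show "\<forall>\<^sub>F t in at_top. measure U {t<..t + x} < a"
    proof eventually_elim
      case (elim t)
      have "(\<integral>y. indicator {t<..t + x} y \<partial>U) \<le> smoothed (x / 2 + e) e (t + x / 2)"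
        unfolding smoothed_def
      proof (rule integral_mono[OF int])
        show "integrable U (\<lambda>y. plateau (x / 2 + e) e (t + x / 2 - y))"
          using \<open>0 < e\<close> \<open>0 < x\<close> by (intro integrable_shifted_plateau) auto
        fix y
        show "indicator {t<..t + x} y \<le> plateau (x / 2 + e) e (t + x / 2 - y)"
          using indicator_le_plateau[OF \<open>0 < e\<close>, of "x / 2 + e" "t + x / 2 - y"]
          by (auto simp: indicator_def split: if_splits)
      qed
      with elim show ?case by simp
    qed
  }
qed

end

section \<open>Independence of variables with different value types\<close>

lemma (in prob_space) nn_integral_pair_product_distr:
  assumes "A \<in> measurable M N1" "B \<in> measurable M N2"
    and prod: "distr M (N1 \<Otimes>\<^sub>M N2) (\<lambda>\<omega>. (A \<omega>, B \<omega>)) = distr M N1 A \<Otimes>\<^sub>M distr M N2 B"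
    and [measurable]: "\<psi> \<in> borel_measurable (N1 \<Otimes>\<^sub>M N2)"
  shows "(\<integral>\<^sup>+\<omega>. \<psi> (A \<omega>, B \<omega>) \<partial>M) = (\<integral>\<^sup>+\<omega>. \<integral>\<^sup>+\<omega>'. \<psi> (A \<omega>, B \<omega>') \<partial>M \<partial>M)"
proof -
  note [measurable] = assms(1,2)
  interpret B: prob_space "distr M N2 B" by (rule prob_space_distr) fact
  have "(\<integral>\<^sup>+\<omega>. \<psi> (A \<omega>, B \<omega>) \<partial>M) = (\<integral>\<^sup>+p. \<psi> p \<partial>(distr M N1 A \<Otimes>\<^sub>M distr M N2 B))"
    unfolding prod[symmetric] by (simp add: nn_integral_distr)
  also have "\<dots> = (\<integral>\<^sup>+a. \<integral>\<^sup>+b. \<psi> (a, b) \<partial>distr M N2 B \<partial>distr M N1 A)"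
    by (subst B.nn_integral_fst) auto
  also have "\<dots> = (\<integral>\<^sup>+\<omega>. \<integral>\<^sup>+\<omega>'. \<psi> (A \<omega>, B \<omega>') \<partial>M \<partial>M)"
    by (subst nn_integral_distr) (auto simp: nn_integral_distr intro!: nn_integral_cong)
  finally show ?thesis .
qed

text \<open>
  Independence of generated sigma-algebras is the form that makes sense for two variables of
  different types; rectangles determine the joint law.
\<close>
lemma (in prob_space) distr_pair_of_indep_set:
  assumes A: "A \<in> measurable M N1" and B: "B \<in> measurable M N2"
    and indep: "indep_set (sets (vimage_algebra (space M) A N1)) (sets (vimage_algebra (space M) B N2))"
  shows "distr M (N1 \<Otimes>\<^sub>M N2) (\<lambda>\<omega>. (A \<omega>, B \<omega>)) = distr M N1 A \<Otimes>\<^sub>M distr M N2 B"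
proof (rule sym, rule pair_measure_eqI)
  note [measurable] = A B
  interpret A: prob_space "distr M N1 A" by (rule prob_space_distr) fact
  interpret B: prob_space "distr M N2 B" by (rule prob_space_distr) fact
  show "sigma_finite_measure (distr M N1 A)" "sigma_finite_measure (distr M N2 B)" by unfold_locales
  show "sets (distr M N1 A \<Otimes>\<^sub>M distr M N2 B) = sets (distr M (N1 \<Otimes>\<^sub>M N2) (\<lambda>\<omega>. (A \<omega>, B \<omega>)))"
    by simp
  fix a b assume ab: "a \<in> sets (distr M N1 A)" "b \<in> sets (distr M N2 B)"
  have "prob ((A -` a \<inter> space M) \<inter> (B -` b \<inter> space M)) = prob (A -` a \<inter> space M) * prob (B -` b \<inter> space M)"
    using ab by (intro indep_setD[OF indep] in_vimage_algebra) auto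
  moreover have "(\<lambda>\<omega>. (A \<omega>, B \<omega>)) -` (a \<times> b) \<inter> space M = (A -` a \<inter> space M) \<inter> (B -` b \<inter> space M)"
    by auto
  ultimately show "emeasure (distr M N1 A) a * emeasure (distr M N2 B) b
      = emeasure (distr M (N1 \<Otimes>\<^sub>M N2) (\<lambda>\<omega>. (A \<omega>, B \<omega>))) (a \<times> b)"
    using ab by (simp add: emeasure_distr emeasure_eq_measure ennreal_mult)
qed

lemma measurable_sum_upto:
  fixes f :: "nat \<Rightarrow> 'a \<Rightarrow> 'b :: {second_countable_topology, topological_comm_monoid_add}"
  assumes [measurable]: "N \<in> measurable M (count_space UNIV)"
    and f: "\<And>j. 1 \<le> j \<Longrightarrow> f j \<in> borel_measurable M"
  shows "(\<lambda>\<omega>. \<Sum>j=1..N \<omega>. f j \<omega>) \<in> borel_measurable M"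
  by (rule measurable_compose_countable[where f="\<lambda>n \<omega>. \<Sum>j=1..n. f j \<omega>", OF _ assms(1)])
    (auto intro!: borel_measurable_sum f)

lemma suminf_split_first_ennreal: "(\<Sum>n. f n) = f 0 + (\<Sum>n. f (Suc n))" for f :: "nat \<Rightarrow> ennreal"
  using sums_Suc[OF summable_sums[OF summableI, of "\<lambda>n. f (Suc n)"]]
  by (simp add: sums_iff add.commute)

section \<open>The renewal measure of a cluster process\<close>

context renewal_cluster_process
begin

abbreviation W :: "nat \<Rightarrow> 'a \<Rightarrow> cluster" where "W \<equiv> cluster_pair L T X"
abbreviation S :: "nat \<Rightarrow> 'a \<Rightarrow> real" where "S \<equiv> renewal_time X"

lemma cluster_count_measurable [measurable]: "fst \<in> measurable cluster_space (count_space UNIV)"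
  and cluster_position_measurable: "1 \<le> j \<Longrightarrow> (\<lambda>w. fst (snd w) j) \<in> borel_measurable cluster_space"
  and cluster_increment_measurable [measurable]: "(\<lambda>w. snd (snd w)) \<in> borel_measurable cluster_space"
proof -
  show "fst \<in> measurable cluster_space (count_space UNIV)"
    and "(\<lambda>w. snd (snd w)) \<in> borel_measurable cluster_space"
    unfolding cluster_space_def by measurable
  assume "1 \<le> j"
  then have [measurable]: "(\<lambda>\<tau>. \<tau> j) \<in> borel_measurable (\<Pi>\<^sub>M j\<in>{1..}. borel)"
    by (intro measurable_component_singleton) auto
  show "(\<lambda>w. fst (snd w) j) \<in> borel_measurable cluster_space"
    unfolding cluster_space_def by measurable
qed

lemmas [measurable] = random_pair

lemma L_measurable [measurable]: "L i \<in> measurable M (count_space UNIV)"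
  using measurable_compose[OF random_pair cluster_count_measurable] by (simp add: cluster_pair_def)

lemma X_measurable [measurable]: "X i \<in> borel_measurable M"
  using measurable_compose[OF random_pair cluster_increment_measurable] by (simp add: cluster_pair_def)

lemma T_measurable: "1 \<le> j \<Longrightarrow> T i j \<in> borel_measurable M"
  using measurable_compose[OF random_pair cluster_position_measurable[of j]] by (simp add: cluster_pair_def)

lemma S_measurable [measurable]: "S i \<in> borel_measurable M"
  unfolding renewal_time_def[abs_def] by measurable

lemma S_Suc: "S (Suc n) \<omega> = S n \<omega> + X (Suc n) \<omega>"
  by (simp add: renewal_time_def)

text \<open>
  The time \<open>S n\<close> is a function of the pairs 0 to \<open>n\<close>, hence independent of the next pair, which has
  the law of the first. The proof separates the initial pair from the sequence \<open>Z\<close> of later pairs,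
  then the part of \<open>Z\<close> that enters \<open>S n\<close> from its next entry, and finally puts \<open>S n\<close> together again.
\<close>
lemma nn_integral_next_cluster:
  assumes [measurable]: "\<phi> \<in> borel_measurable (borel \<Otimes>\<^sub>M cluster_space)"
  shows "(\<integral>\<^sup>+\<omega>. \<phi> (S n \<omega>, W (Suc n) \<omega>) \<partial>M) = (\<integral>\<^sup>+\<omega>. \<integral>\<^sup>+\<omega>'. \<phi> (S n \<omega>, W 1 \<omega>') \<partial>M \<partial>M)"
proof -
  define Z where "Z \<omega> = (\<lambda>i\<in>{1..}. W i \<omega>)" for \<omega>
  let ?P = "\<lambda>I. \<Pi>\<^sub>M i\<in>I. cluster_space"
  define Y where "Y z = (\<Sum>j\<in>{1..n}. snd (snd (z j)))" for z :: "nat \<Rightarrow> cluster"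
  have [measurable]: "Z \<in> measurable M (?P {1..})"
    unfolding Z_def by (intro measurable_restrict random_pair)
  have comp: "(\<lambda>z. z i) \<in> measurable (?P I) cluster_space" if "i \<in> I" for i I
    using that by (rule measurable_component_singleton)
  have Y: "Y \<in> borel_measurable (?P I)" if "{1..n} \<subseteq> I" for I
    unfolding Y_def[abs_def]
    by (intro borel_measurable_sum measurable_compose[OF comp cluster_increment_measurable]) (use that in auto)
  have [measurable]: "Y \<in> borel_measurable (?P {1..})" "Y \<in> borel_measurable (?P {1..n})"
      "(\<lambda>z. z (Suc n)) \<in> measurable (?P {1..}) cluster_space"
      "(\<lambda>z. z (Suc n)) \<in> measurable (?P {Suc n}) cluster_space"
    by (auto intro!: Y comp)
  have S_Z: "S n \<omega> = snd (snd (W 0 \<omega>)) + Y (Z \<omega>)" for \<omega>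
    by (simp add: renewal_time_def Y_def Z_def cluster_pair_def sum.atLeast_Suc_atMost)
  have W_Z: "W (Suc n) \<omega> = Z \<omega> (Suc n)" for \<omega>
    by (simp add: Z_def)
  have init: "distr M (cluster_space \<Otimes>\<^sub>M ?P {1..}) (\<lambda>\<omega>. (W 0 \<omega>, Z \<omega>))
      = distr M cluster_space (W 0) \<Otimes>\<^sub>M distr M (?P {1..}) Z"
    using indep_initial by (intro distr_pair_of_indep_set) (auto simp: Z_def[abs_def])
  have "indep_var (?P {1..n}) (\<lambda>\<omega>. \<lambda>i\<in>{1..n}. W i \<omega>) (?P {Suc n}) (\<lambda>\<omega>. \<lambda>i\<in>{Suc n}. W i \<omega>)"
    by (rule indep_var_restrict[OF indep_pairs]) auto
  then have later: "distr M (?P {1..n} \<Otimes>\<^sub>M ?P {Suc n}) (\<lambda>\<omega>. (\<lambda>i\<in>{1..n}. W i \<omega>, \<lambda>i\<in>{Suc n}. W i \<omega>))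
      = distr M (?P {1..n}) (\<lambda>\<omega>. \<lambda>i\<in>{1..n}. W i \<omega>) \<Otimes>\<^sub>M distr M (?P {Suc n}) (\<lambda>\<omega>. \<lambda>i\<in>{Suc n}. W i \<omega>)"
    by (simp add: indep_var_distribution_eq)
  have Y_restrict: "Y (\<lambda>i\<in>{1..n}. W i \<omega>) = Y (Z \<omega>)" for \<omega>
    by (auto simp: Y_def Z_def intro!: sum.cong)
  define h where "h s = (\<integral>\<^sup>+\<omega>. \<phi> (s, W 1 \<omega>) \<partial>M)" for s
  have [measurable]: "h \<in> borel_measurable borel"
    unfolding h_def by measurable
  have next_law: "(\<integral>\<^sup>+\<omega>. \<phi> (s, W (Suc n) \<omega>) \<partial>M) = h s" for s
  proof -
    have "(\<integral>\<^sup>+\<omega>. \<phi> (s, W (Suc n) \<omega>) \<partial>M) = (\<integral>\<^sup>+w. \<phi> (s, w) \<partial>distr M cluster_space (W (Suc n)))"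
      by (subst nn_integral_distr) auto
    also have "\<dots> = h s"
      unfolding h_def by (subst ident_pairs) (auto simp: nn_integral_distr)
    finally show ?thesis .
  qed
  have "(\<integral>\<^sup>+\<omega>. \<phi> (S n \<omega>, W (Suc n) \<omega>) \<partial>M)
      = (\<integral>\<^sup>+\<omega>. (\<lambda>(w, z). \<phi> (snd (snd w) + Y z, z (Suc n))) (W 0 \<omega>, Z \<omega>) \<partial>M)"
    by (simp add: S_Z W_Z)
  also have "\<dots> = (\<integral>\<^sup>+\<omega>. \<integral>\<^sup>+\<omega>'. (\<lambda>(w, z). \<phi> (snd (snd w) + Y z, z (Suc n))) (W 0 \<omega>, Z \<omega>') \<partial>M \<partial>M)"
    by (rule nn_integral_pair_product_distr[OF _ _ init]) measurable
  also have "\<dots> = (\<integral>\<^sup>+\<omega>. \<integral>\<^sup>+\<omega>'. h (snd (snd (W 0 \<omega>)) + Y (Z \<omega>')) \<partial>M \<partial>M)"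
  proof (rule nn_integral_cong)
    fix \<omega>
    define c where "c = snd (snd (W 0 \<omega>))"
    have "(\<integral>\<^sup>+\<omega>'. \<phi> (c + Y (Z \<omega>'), Z \<omega>' (Suc n)) \<partial>M)
        = (\<integral>\<^sup>+\<omega>'. (\<lambda>(y, z). \<phi> (c + Y y, z (Suc n))) (\<lambda>i\<in>{1..n}. W i \<omega>', \<lambda>i\<in>{Suc n}. W i \<omega>') \<partial>M)"
      by (simp add: Y_restrict W_Z del: One_nat_def)
    also have "\<dots> = (\<integral>\<^sup>+\<omega>'. \<integral>\<^sup>+\<omega>''. (\<lambda>(y, z). \<phi> (c + Y y, z (Suc n)))
        (\<lambda>i\<in>{1..n}. W i \<omega>', \<lambda>i\<in>{Suc n}. W i \<omega>'') \<partial>M \<partial>M)"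
      by (rule nn_integral_pair_product_distr[OF _ _ later]) measurable
    also have "\<dots> = (\<integral>\<^sup>+\<omega>'. h (c + Y (Z \<omega>')) \<partial>M)"
      by (simp add: Y_restrict next_law del: One_nat_def)
    finally show "(\<integral>\<^sup>+\<omega>'. (\<lambda>(w, z). \<phi> (snd (snd w) + Y z, z (Suc n))) (W 0 \<omega>, Z \<omega>') \<partial>M)
        = (\<integral>\<^sup>+\<omega>'. h (snd (snd (W 0 \<omega>)) + Y (Z \<omega>')) \<partial>M)"
      by (simp add: c_def)
  qed
  also have "\<dots> = (\<integral>\<^sup>+\<omega>. \<integral>\<^sup>+\<omega>'. (\<lambda>(w, z). h (snd (snd w) + Y z)) (W 0 \<omega>, Z \<omega>') \<partial>M \<partial>M)"
    by simp
  also have "\<dots> = (\<integral>\<^sup>+\<omega>. (\<lambda>(w, z). h (snd (snd w) + Y z)) (W 0 \<omega>, Z \<omega>) \<partial>M)"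
    by (rule nn_integral_pair_product_distr[OF _ _ init, symmetric]) measurable
  also have "\<dots> = (\<integral>\<^sup>+\<omega>. h (S n \<omega>) \<partial>M)"
    by (simp add: S_Z)
  finally show ?thesis by (simp add: h_def)
qed

lemma nn_integral_next_increment:
  assumes [measurable]: "g \<in> borel_measurable borel"
  shows "(\<integral>\<^sup>+\<omega>. g (S (Suc n) \<omega>) \<partial>M) = (\<integral>\<^sup>+\<omega>. \<integral>\<^sup>+\<omega>'. g (S n \<omega> + X 1 \<omega>') \<partial>M \<partial>M)"
  using nn_integral_next_cluster[of "\<lambda>(s, w). g (s + snd (snd w))" n]
  by (simp add: S_Suc cluster_pair_def)

definition renewal :: "real measure" where
  "renewal = distr (count_space UNIV \<Otimes>\<^sub>M M) borel (\<lambda>(n, \<omega>). S n \<omega>)"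

lemma sets_renewal [simp, measurable_cong]: "sets renewal = sets borel"
  by (simp add: renewal_def)

lemma nn_integral_renewal:
  assumes [measurable]: "g \<in> borel_measurable borel"
  shows "(\<integral>\<^sup>+s. g s \<partial>renewal) = (\<Sum>n. \<integral>\<^sup>+\<omega>. g (S n \<omega>) \<partial>M)"
proof -
  have [measurable]: "(\<lambda>(n, \<omega>). S n \<omega>) \<in> borel_measurable (count_space UNIV \<Otimes>\<^sub>M M)"
    by (rule measurable_pair_measure_countable1) auto
  have "(\<integral>\<^sup>+s. g s \<partial>renewal) = (\<integral>\<^sup>+p. g (case p of (n, \<omega>) \<Rightarrow> S n \<omega>) \<partial>(count_space UNIV \<Otimes>\<^sub>M M))"
    unfolding renewal_def by (rule nn_integral_distr) auto
  also have "\<dots> = (\<integral>\<^sup>+n. \<integral>\<^sup>+\<omega>. g (S n \<omega>) \<partial>M \<partial>count_space UNIV)"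
    by (subst nn_integral_fst[symmetric]) auto
  finally show ?thesis by (simp add: nn_integral_count_space_nat)
qed

text \<open>
  A nonnegative variable whose Laplace transform at 1 equals 1 vanishes almost surely.
\<close>
lemma laplace_transform_less_1: obtains q where "0 \<le> q" "q < 1" "(\<integral>\<^sup>+\<omega>. ennreal (exp (- X 1 \<omega>)) \<partial>M) = ennreal q"
proof
  define q where "q = expectation (\<lambda>\<omega>. exp (- X 1 \<omega>))"
  have int: "integrable M (\<lambda>\<omega>. exp (- X 1 \<omega>))"
    using X_nonneg by (intro integrable_const_bound[of _ 1]) auto
  show "0 \<le> q" by (simp add: q_def)
  show "(\<integral>\<^sup>+\<omega>. ennreal (exp (- X 1 \<omega>)) \<partial>M) = ennreal q"
    unfolding q_def by (rule nn_integral_eq_integral[OF int]) simp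
  have nonneg: "AE \<omega> in M. 0 \<le> 1 - exp (- X 1 \<omega>)"
    using X_nonneg by (intro AE_I2) simp
  have diff: "expectation (\<lambda>\<omega>. 1 - exp (- X 1 \<omega>)) = 1 - q"
    using int by (simp add: q_def prob_space)
  have "1 - q \<noteq> 0"
  proof
    assume "1 - q = 0"
    then have "AE \<omega> in M. 1 - exp (- X 1 \<omega>) = 0"
      using diff int nonneg by (subst integral_nonneg_eq_0_iff_AE[symmetric]) auto
    then have "AE \<omega> in M. X 1 \<omega> = 0" by eventually_elim simp
    then have "expectation (X 1) = 0" by (subst integral_cong_AE[where g="\<lambda>_. 0"]) auto
    then show False using mean_X_pos by simp
  qed
  moreover have "0 \<le> 1 - q" unfolding diff[symmetric] by (rule integral_nonneg_AE[OF nonneg])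
  ultimately show "q < 1" by simp
qed

text \<open>
  The Laplace transform of \<open>S n\<close> decays geometrically, so the transform of the renewal measure is
  finite at 1; on \<open>{..t}\<close> the function \<open>exp (- s)\<close> is bounded below.
\<close>
lemma emeasure_renewal_atMost: "emeasure renewal {..t} < \<infinity>"
proof -
  obtain q where q: "0 \<le> q" "q < 1" "(\<integral>\<^sup>+\<omega>. ennreal (exp (- X 1 \<omega>)) \<partial>M) = ennreal q"
    by (rule laplace_transform_less_1)
  have geom: "(\<integral>\<^sup>+\<omega>. ennreal (exp (- S n \<omega>)) \<partial>M) \<le> ennreal (q ^ n)" for n
  proof (induction n)
    case 0
    have "(\<integral>\<^sup>+\<omega>. ennreal (exp (- S 0 \<omega>)) \<partial>M) \<le> (\<integral>\<^sup>+\<omega>. 1 \<partial>M)"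
      using X_nonneg by (intro nn_integral_mono) (simp add: renewal_time_def)
    then show ?case by (simp add: emeasure_space_1)
  next
    case (Suc n)
    have "(\<integral>\<^sup>+\<omega>. ennreal (exp (- S (Suc n) \<omega>)) \<partial>M)
        = (\<integral>\<^sup>+\<omega>. \<integral>\<^sup>+\<omega>'. ennreal (exp (- S n \<omega>)) * ennreal (exp (- X 1 \<omega>')) \<partial>M \<partial>M)"
      by (subst nn_integral_next_increment) (simp_all add: exp_add[symmetric] ennreal_mult[symmetric])
    also have "\<dots> = (\<integral>\<^sup>+\<omega>. ennreal (exp (- S n \<omega>)) \<partial>M) * ennreal q"
      by (simp add: nn_integral_cmult nn_integral_multc q(3)[simplified])
    also have "\<dots> \<le> ennreal (q ^ n) * ennreal q" by (intro mult_right_mono Suc.IH) simp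
    finally show ?case using q(1) by (simp add: ennreal_mult[symmetric] mult.commute)
  qed
  have "emeasure renewal {..t} = (\<integral>\<^sup>+s. indicator {..t} s \<partial>renewal)" by simp
  also have "\<dots> \<le> (\<integral>\<^sup>+s. ennreal (exp t) * ennreal (exp (- s)) \<partial>renewal)"
    by (intro nn_integral_mono) (auto simp: indicator_def ennreal_mult[symmetric] exp_add[symmetric])
  also have "\<dots> = ennreal (exp t) * (\<Sum>n. \<integral>\<^sup>+\<omega>. ennreal (exp (- S n \<omega>)) \<partial>M)"
    by (simp add: nn_integral_cmult nn_integral_renewal)
  also have "\<dots> \<le> ennreal (exp t) * (\<Sum>n. ennreal (q ^ n))"
    by (intro mult_left_mono suminf_le geom summableI) simp
  also have "\<dots> < \<infinity>"
    using q by (simp add: suminf_ennreal2 summable_geometric ennreal_mult_less_top)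
  finally show ?thesis .
qed

sublocale R: renewal_measure "distr M borel (X 1)" "distr M borel (X 0)" renewal
proof (rule renewal_measure.intro)
  show "real_distribution (distr M borel (X 1))" "real_distribution (distr M borel (X 0))"
    by (intro real_distribution_distr X_measurable)+
  show "renewal_measure_axioms (distr M borel (X 1)) (distr M borel (X 0)) renewal"
  proof
    fix g :: "real \<Rightarrow> ennreal" assume [measurable]: "g \<in> borel_measurable borel"
    have "(\<integral>\<^sup>+x. g x \<partial>renewal) = (\<integral>\<^sup>+\<omega>. g (S 0 \<omega>) \<partial>M) + (\<Sum>n. \<integral>\<^sup>+\<omega>. g (S (Suc n) \<omega>) \<partial>M)"
      by (subst nn_integral_renewal) (auto intro: suminf_split_first_ennreal)
    also have "(\<Sum>n. \<integral>\<^sup>+\<omega>. g (S (Suc n) \<omega>) \<partial>M) = (\<integral>\<^sup>+x. \<integral>\<^sup>+\<omega>'. g (x + X 1 \<omega>') \<partial>M \<partial>renewal)"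
      by (simp add: nn_integral_next_increment nn_integral_renewal)
    also have "(\<integral>\<^sup>+\<omega>. g (S 0 \<omega>) \<partial>M) = (\<integral>\<^sup>+x. g x \<partial>distr M borel (X 0))"
      by (simp add: nn_integral_distr renewal_time_def)
    finally show "(\<integral>\<^sup>+x. g x \<partial>renewal) = (\<integral>\<^sup>+x. g x \<partial>distr M borel (X 0))
        + (\<integral>\<^sup>+x. \<integral>\<^sup>+y. g (x + y) \<partial>distr M borel (X 1) \<partial>renewal)"
      by (simp add: nn_integral_distr)
  next
    show "emeasure renewal {..t} < \<infinity>" for t by (rule emeasure_renewal_atMost)
    show "AE y in distr M borel (X 1). 0 \<le> y"
      using X_nonneg by (subst AE_distr_iff) auto
    show "integrable (distr M borel (X 1)) (\<lambda>y. y)"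
      using integrable_X by (subst integrable_distr_eq) auto
    show "0 < (\<integral>y. y \<partial>distr M borel (X 1))"
      using mean_X_pos by (subst integral_distr) auto
  qed simp
qed

section \<open>The mean measure of a cluster process\<close>

text \<open>
  The points of cluster \<open>i + 1\<close> sit at \<open>S i + X (i + 1) + T (i + 1) j\<close>. Given that pair, which is
  independent of \<open>S i\<close>, the sum over \<open>i\<close> turns the law of \<open>S i\<close> into the renewal measure, evaluated
  at the window moved back by the position of the point inside one typical cluster. The increment
  and the cluster may depend on each other, since both stay inside the outer expectation.
\<close>
lemma intensity_decomposition:
  "(\<integral>\<^sup>+\<omega>. emeasure (cluster_process L T X \<omega>) {t<..t + x} \<partial>M)
    = (\<integral>\<^sup>+\<omega>. (\<Sum>j=1..L 0 \<omega>. indicator {t<..t + x} (X 0 \<omega> + T 0 j \<omega>)) \<partial>M)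
    + (\<integral>\<^sup>+\<omega>. (\<Sum>j=1..L 1 \<omega>. emeasure renewal {t - X 1 \<omega> - T 1 j \<omega><..t - X 1 \<omega> - T 1 j \<omega> + x}) \<partial>M)"
proof -
  let ?B = "{t<..t + x}"
  \<comment> \<open>The number of points that cluster \<open>w\<close>, placed at time \<open>s\<close>, puts into the window.\<close>
  define N where "N s w = (\<Sum>j=1..fst w. indicator ?B (s + fst (snd w) j) :: ennreal)"
    for s :: real and w :: cluster
  have N_measurable: "case_prod N \<in> borel_measurable (borel \<Otimes>\<^sub>M cluster_space)"
  proof -
    have "(\<lambda>p. \<Sum>j=1..fst (snd p). indicator ?B (fst p + fst (snd (snd p)) j) :: ennreal)
        \<in> borel_measurable (borel \<Otimes>\<^sub>M cluster_space)"
    proof (rule measurable_sum_upto)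
      show "(\<lambda>p. fst (snd p)) \<in> measurable (borel \<Otimes>\<^sub>M cluster_space) (count_space UNIV)" by measurable
      fix j :: nat assume "1 \<le> j"
      note [measurable] = cluster_position_measurable[OF this]
      show "(\<lambda>p. indicator ?B (fst p + fst (snd (snd p)) j) :: ennreal)
          \<in> borel_measurable (borel \<Otimes>\<^sub>M cluster_space)" by measurable
    qed
    then show ?thesis by (simp add: N_def split_beta')
  qed
  have N_step: "(\<lambda>(s, w). N (s + snd (snd w)) w) \<in> borel_measurable (borel \<Otimes>\<^sub>M cluster_space)"
    using measurable_compose[OF _ N_measurable, of "\<lambda>(s, w). (s + snd (snd w), w)" "borel \<Otimes>\<^sub>M cluster_space"]
    by (simp add: split_beta')
  have N_W: "N (S i \<omega>) (W i \<omega>) = (\<Sum>j=1..L i \<omega>. indicator ?B (S i \<omega> + T i j \<omega>))" for i \<omega>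
    by (auto simp: N_def cluster_pair_def intro!: sum.cong)
  have N_S: "(\<lambda>\<omega>. N (S i \<omega>) (W i \<omega>)) \<in> borel_measurable M" for i
    using measurable_compose[OF _ N_measurable, of "\<lambda>\<omega>. (S i \<omega>, W i \<omega>)" M] by simp
  have "(\<integral>\<^sup>+\<omega>. emeasure (cluster_process L T X \<omega>) ?B \<partial>M) = (\<integral>\<^sup>+\<omega>. (\<Sum>i. N (S i \<omega>) (W i \<omega>)) \<partial>M)"
    by (simp add: emeasure_cluster_process N_W)
  also have "\<dots> = (\<Sum>i. \<integral>\<^sup>+\<omega>. N (S i \<omega>) (W i \<omega>) \<partial>M)"
    by (intro nn_integral_suminf N_S)
  also have "\<dots> = (\<integral>\<^sup>+\<omega>. N (S 0 \<omega>) (W 0 \<omega>) \<partial>M) + (\<Sum>i. \<integral>\<^sup>+\<omega>. N (S (Suc i) \<omega>) (W (Suc i) \<omega>) \<partial>M)"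
    by (rule suminf_split_first_ennreal)
  also have "(\<Sum>i. \<integral>\<^sup>+\<omega>. N (S (Suc i) \<omega>) (W (Suc i) \<omega>) \<partial>M)
      = (\<Sum>i. \<integral>\<^sup>+\<omega>. \<integral>\<^sup>+\<omega>'. N (S i \<omega> + X 1 \<omega>') (W 1 \<omega>') \<partial>M \<partial>M)"
    using nn_integral_next_cluster[OF N_step] by (simp add: S_Suc cluster_pair_def)
  also have "\<dots> = (\<integral>\<^sup>+s. \<integral>\<^sup>+\<omega>'. N (s + X 1 \<omega>') (W 1 \<omega>') \<partial>M \<partial>renewal)"
  proof (rule nn_integral_renewal[symmetric])
    have "(\<lambda>(s, \<omega>'). N (s + X 1 \<omega>') (W 1 \<omega>')) \<in> borel_measurable (borel \<Otimes>\<^sub>M M)"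
      using measurable_compose[OF _ N_measurable, of "\<lambda>(s, \<omega>). (s + X 1 \<omega>, W 1 \<omega>)" "borel \<Otimes>\<^sub>M M"]
      by (simp add: split_beta')
    then show "(\<lambda>s. \<integral>\<^sup>+\<omega>'. N (s + X 1 \<omega>') (W 1 \<omega>') \<partial>M) \<in> borel_measurable borel"
      by measurable
  qed
  also have "\<dots> = (\<integral>\<^sup>+\<omega>'. \<integral>\<^sup>+s. N (s + X 1 \<omega>') (W 1 \<omega>') \<partial>renewal \<partial>M)"
  proof -
    interpret pair_sigma_finite renewal M ..
    have "(\<lambda>(s, \<omega>'). N (s + X 1 \<omega>') (W 1 \<omega>')) \<in> borel_measurable (renewal \<Otimes>\<^sub>M M)"
      using measurable_compose[OF _ N_measurable, of "\<lambda>(s, \<omega>). (s + X 1 \<omega>, W 1 \<omega>)" "renewal \<Otimes>\<^sub>M M"]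
      by (simp add: split_beta')
    then show ?thesis by (rule Fubini'[symmetric])
  qed
  also have "\<dots> = (\<integral>\<^sup>+\<omega>. (\<Sum>j=1..L 1 \<omega>.
      emeasure renewal {t - X 1 \<omega> - T 1 j \<omega><..t - X 1 \<omega> - T 1 j \<omega> + x}) \<partial>M)"
  proof (rule nn_integral_cong)
    fix \<omega>
    have "(\<integral>\<^sup>+s. N (s + X 1 \<omega>) (W 1 \<omega>) \<partial>renewal)
        = (\<integral>\<^sup>+s. (\<Sum>j=1..L 1 \<omega>. indicator {t - X 1 \<omega> - T 1 j \<omega><..t - X 1 \<omega> - T 1 j \<omega> + x} s) \<partial>renewal)"
      unfolding N_def cluster_pair_def fst_conv snd_conv
      by (intro nn_integral_cong sum.cong refl) (auto simp: indicator_def algebra_simps)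
    also have "\<dots> = (\<Sum>j=1..L 1 \<omega>.
        emeasure renewal {t - X 1 \<omega> - T 1 j \<omega><..t - X 1 \<omega> - T 1 j \<omega> + x})"
      by (subst nn_integral_sum) auto
    finally show "(\<integral>\<^sup>+s. N (s + X 1 \<omega>) (W 1 \<omega>) \<partial>renewal) = \<dots>" .
  qed
  also have "(\<integral>\<^sup>+\<omega>. N (S 0 \<omega>) (W 0 \<omega>) \<partial>M)
      = (\<integral>\<^sup>+\<omega>. (\<Sum>j=1..L 0 \<omega>. indicator ?B (X 0 \<omega> + T 0 j \<omega>)) \<partial>M)"
    unfolding N_W by (simp add: renewal_time_def)
  finally show ?thesis .
qed

lemma initial_cluster_vanishes:
  assumes "integrable M (\<lambda>\<omega>. real (L 0 \<omega>))"
  shows "((\<lambda>t. \<integral>\<^sup>+\<omega>. (\<Sum>j=1..L 0 \<omega>. indicator {t<..t + x} (X 0 \<omega> + T 0 j \<omega>)) \<partial>M) \<longlongrightarrow> 0) at_top"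
proof -
  define f where "f t \<omega> = (\<Sum>j=1..L 0 \<omega>. indicator {t<..t + x} (X 0 \<omega> + T 0 j \<omega>) :: real)" for t \<omega>
  have [measurable]: "f t \<in> borel_measurable M" for t
    unfolding f_def[abs_def]
  proof (rule measurable_sum_upto)
    fix j :: nat assume "1 \<le> j"
    note [measurable] = T_measurable[OF this]
    show "(\<lambda>\<omega>. indicator {t<..t + x} (X 0 \<omega> + T 0 j \<omega>) :: real) \<in> borel_measurable M" by measurable
  qed measurable
  have bound: "0 \<le> f t \<omega>" "f t \<omega> \<le> real (L 0 \<omega>)" for t \<omega>
    using sum_bounded_above[of "{1..L 0 \<omega>}" "\<lambda>j. indicator {t<..t + x} (X 0 \<omega> + T 0 j \<omega>)" "1 :: real"]
    by (auto simp: f_def sum_nonneg)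
  have "((\<lambda>t. \<integral>\<omega>. f t \<omega> \<partial>M) \<longlongrightarrow> (\<integral>\<omega>. 0 \<partial>M)) at_top"
  proof (rule integral_dominated_convergence_at_top[OF _ _ assms])
    show "AE \<omega> in M. ((\<lambda>t. f t \<omega>) \<longlongrightarrow> 0) at_top"
    proof (rule AE_I2)
      fix \<omega>
      have "((\<lambda>t. indicator {t<..t + x} c :: real) \<longlongrightarrow> 0) at_top" for c :: real
        by (rule tendsto_eventually) (use eventually_ge_at_top[of c] in eventually_elim, auto)
      then have "((\<lambda>t. f t \<omega>) \<longlongrightarrow> (\<Sum>j=1..L 0 \<omega>. 0)) at_top"
        unfolding f_def by (intro tendsto_sum) auto
      then show "((\<lambda>t. f t \<omega>) \<longlongrightarrow> 0) at_top" by simp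
    qed
    show "\<forall>\<^sub>F t in at_top. AE \<omega> in M. norm (f t \<omega>) \<le> real (L 0 \<omega>)"
      using bound by (intro always_eventually allI AE_I2) simp
  qed auto
  then have "((\<lambda>t. ennreal (\<integral>\<omega>. f t \<omega> \<partial>M)) \<longlongrightarrow> ennreal 0) at_top"
    by (intro tendsto_ennrealI) simp
  moreover have "(\<integral>\<^sup>+\<omega>. (\<Sum>j=1..L 0 \<omega>. indicator {t<..t + x} (X 0 \<omega> + T 0 j \<omega>)) \<partial>M)
      = ennreal (\<integral>\<omega>. f t \<omega> \<partial>M)" for t
  proof -
    have "integrable M (f t)"
      using assms by (rule Bochner_Integration.integrable_bound) (use bound in auto)
    then have "ennreal (\<integral>\<omega>. f t \<omega> \<partial>M) = (\<integral>\<^sup>+\<omega>. ennreal (f t \<omega>) \<partial>M)"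
      using bound by (intro nn_integral_eq_integral[symmetric]) auto
    also have "\<dots> = (\<integral>\<^sup>+\<omega>. (\<Sum>j=1..L 0 \<omega>. indicator {t<..t + x} (X 0 \<omega> + T 0 j \<omega>)) \<partial>M)"
      by (simp add: f_def sum_ennreal[symmetric] ennreal_indicator del: sum_ennreal)
    finally show ?thesis ..
  qed
  ultimately show ?thesis by simp
qed

text \<open>
  For each outcome the sum has \<open>L 1\<close> terms, each tending to \<open>x / \<mu>\<close> by Blackwell's theorem, and each
  at most \<open>C\<close> because windows of fixed length have bounded renewal measure. So \<open>C * L 1\<close> dominates.
\<close>
lemma later_clusters_limit:
  assumes int_L: "integrable M (\<lambda>\<omega>. real (L 1 \<omega>))" and "0 < x"
  shows "((\<lambda>t. \<integral>\<^sup>+\<omega>. (\<Sum>j=1..L 1 \<omega>.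
      emeasure renewal {t - X 1 \<omega> - T 1 j \<omega><..t - X 1 \<omega> - T 1 j \<omega> + x}) \<partial>M)
    \<longlongrightarrow> ennreal (1 / expectation (X 1) * expectation (\<lambda>\<omega>. real (L 1 \<omega>)) * x)) at_top"
proof -
  let ?\<mu> = "expectation (X 1)"
  define u where "u t = measure renewal {t<..t + x}" for t
  have [measurable]: "u \<in> borel_measurable borel"
    unfolding u_def by (rule R.window_measurable)
  have u_lim: "(u \<longlongrightarrow> x / ?\<mu>) at_top"
    using R.blackwell[OF nonarithmetic_X \<open>0 < x\<close>] by (simp add: u_def[abs_def] integral_distr)
  obtain C where C: "0 \<le> C" "\<And>t. emeasure renewal {t..t + x} \<le> ennreal C"
    using R.window_bounded[of x] by blast
  have emeasure_u: "emeasure renewal {t<..t + x} = ennreal (u t)" for t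
    unfolding u_def using R.emeasure_U_bounded[of "{t<..t + x}"]
    by (intro emeasure_eq_ennreal_measure) auto
  have u_bound: "0 \<le> u t" "u t \<le> C" for t
  proof -
    have "ennreal (u t) \<le> emeasure renewal {t..t + x}"
      unfolding emeasure_u[symmetric] by (intro emeasure_mono) auto
    also note C(2)
    finally show "u t \<le> C" using C(1) by simp
  qed (simp add: u_def)
  define f where "f t \<omega> = (\<Sum>j=1..L 1 \<omega>. u (t - X 1 \<omega> - T 1 j \<omega>))" for t \<omega>
  have [measurable]: "f t \<in> borel_measurable M" for t
    unfolding f_def[abs_def]
  proof (rule measurable_sum_upto)
    fix j :: nat assume "1 \<le> j"
    note [measurable] = T_measurable[OF this]
    show "(\<lambda>\<omega>. u (t - X 1 \<omega> - T 1 j \<omega>)) \<in> borel_measurable M" by measurable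
  qed measurable
  have bound: "0 \<le> f t \<omega>" "f t \<omega> \<le> real (L 1 \<omega>) * C" for t \<omega>
    using sum_bounded_above[of "{1..L 1 \<omega>}" "\<lambda>j. u (t - X 1 \<omega> - T 1 j \<omega>)" C] u_bound
    by (auto simp: f_def sum_nonneg)
  have int_LC: "integrable M (\<lambda>\<omega>. real (L 1 \<omega>) * C)" using int_L by simp
  have "((\<lambda>t. \<integral>\<omega>. f t \<omega> \<partial>M) \<longlongrightarrow> (\<integral>\<omega>. real (L 1 \<omega>) * (x / ?\<mu>) \<partial>M)) at_top"
  proof (rule integral_dominated_convergence_at_top[OF _ _ int_LC])
    show "AE \<omega> in M. ((\<lambda>t. f t \<omega>) \<longlongrightarrow> real (L 1 \<omega>) * (x / ?\<mu>)) at_top"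
    proof (rule AE_I2)
      fix \<omega>
      have "filterlim (\<lambda>t. t - X 1 \<omega> - T 1 j \<omega>) at_top at_top" for j
        using filterlim_tendsto_add_at_top[OF tendsto_const[of "- X 1 \<omega> - T 1 j \<omega>"] filterlim_ident]
        by (simp add: algebra_simps)
      then have "((\<lambda>t. f t \<omega>) \<longlongrightarrow> (\<Sum>j=1..L 1 \<omega>. x / ?\<mu>)) at_top"
        unfolding f_def by (intro tendsto_sum filterlim_compose[OF u_lim])
      then show "((\<lambda>t. f t \<omega>) \<longlongrightarrow> real (L 1 \<omega>) * (x / ?\<mu>)) at_top" by simp
    qed
    show "\<forall>\<^sub>F t in at_top. AE \<omega> in M. norm (f t \<omega>) \<le> real (L 1 \<omega>) * C"
      using bound by (intro always_eventually allI AE_I2) simp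
  qed auto
  then have "((\<lambda>t. ennreal (\<integral>\<omega>. f t \<omega> \<partial>M)) \<longlongrightarrow>
      ennreal (1 / ?\<mu> * expectation (\<lambda>\<omega>. real (L 1 \<omega>)) * x)) at_top"
    by (intro tendsto_ennrealI) (simp add: mult.commute)
  moreover have "(\<integral>\<^sup>+\<omega>. (\<Sum>j=1..L 1 \<omega>.
      emeasure renewal {t - X 1 \<omega> - T 1 j \<omega><..t - X 1 \<omega> - T 1 j \<omega> + x}) \<partial>M)
      = ennreal (\<integral>\<omega>. f t \<omega> \<partial>M)" for t
  proof -
    have "integrable M (f t)"
      using int_LC by (rule Bochner_Integration.integrable_bound) (use bound C(1) in auto)
    then have "ennreal (\<integral>\<omega>. f t \<omega> \<partial>M) = (\<integral>\<^sup>+\<omega>. ennreal (f t \<omega>) \<partial>M)"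
      using bound by (intro nn_integral_eq_integral[symmetric]) auto
    also have "\<dots> = (\<integral>\<^sup>+\<omega>. (\<Sum>j=1..L 1 \<omega>.
        emeasure renewal {t - X 1 \<omega> - T 1 j \<omega><..t - X 1 \<omega> - T 1 j \<omega> + x}) \<partial>M)"
      by (simp add: f_def emeasure_u u_bound(1))
    finally show ?thesis ..
  qed
  ultimately show ?thesis by simp
qed

end

theorem corollary3p7:
  fixes M :: "'a measure"
    and L :: "nat \<Rightarrow> 'a \<Rightarrow> nat"
    and T :: "nat \<Rightarrow> nat \<Rightarrow> 'a \<Rightarrow> real"
    and X :: "nat \<Rightarrow> 'a \<Rightarrow> real"
    and \<mu> x :: real
  assumes "renewal_cluster_process M L T X"
    and "\<mu> = (\<integral>\<omega>. X 1 \<omega> \<partial>M)"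
    and "integrable M (\<lambda>\<omega>. real (L 0 \<omega>))"
    and "integrable M (\<lambda>\<omega>. real (L 1 \<omega>))"
    and "integrable M (\<lambda>\<omega>. real (L 1 \<omega>) * X 1 \<omega>)"
    and "integrable M (\<lambda>\<omega>. real (L 1 \<omega>) * cluster_radius L T 1 \<omega>)"
    and "0 < x"
  shows "((\<lambda>t::real. \<integral>\<^sup>+\<omega>. emeasure (cluster_process L T X \<omega>) {t<..t + x} \<partial>M)
    \<longlongrightarrow> ennreal (1 / \<mu> * (\<integral>\<omega>. real (L 1 \<omega>) \<partial>M) * x)) at_top"
proof -
  interpret renewal_cluster_process M L T X by fact
  show ?thesis
    unfolding intensity_decomposition
    using tendsto_add[OF initial_cluster_vanishes[OF assms(3), of x] later_clusters_limit[OF assms(4,7)]]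
    by (simp add: assms(2))
qed

end
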